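(* Let $(\Xi,d_\Xi)$ be a compact metric space, and let $(H_1,\|\cdot\|_{H_1})$, $(H_2,\|\cdot\|_{H_2})$ be two separable Hilbert spaces. Let $\Xi\ni\xi\mapsto A_\xi\in\mathcal{K}(H_1,H_2)$ be continuous. Fix any integer $n\ge1$ and assume that $\sigma_{n+1}(A_\xi)<\sigma_n(A_\xi)$ for all $\xi\in\Xi$. Then there exists a continuous map $\Xi\ni\xi\mapsto A_\xi^n\in\mathcal{K}(H_1,H_2)$ such that, for every $\xi\in\Xi$, the operator $A_\xi^n$ is an optimal $n$-rank approximation of $A_\xi$ in both the operator and the Hilbert-Schmidt norms. Additionally, if $(\Xi,d_\Xi)$ is contractible to a point, then, for $i=1,\dots,n$, there exist continuous maps $\tilde u_i:\Xi\to H_1$ and $v_i:\Xi\to H_2$ such that, for every $\xi\in\Xi$, one has $\langle v_i(\xi),v_j(\xi)\rangle_{H_2}=\delta_{i,j}$ for all $i,j=1,\dots,n$ and $$A_\xi^n=\sum_{i=1}^n\langle\cdot,\tilde u_i(\xi)\rangle_{H_1}v_i(\xi).$$ The Hilbert-Schmidt version also holds: if $\Xi\ni\xi\mapsto A_\xi\in\mathcal{S}_2(H_1,H_2)$ is continuous with respect to the Hilbert-Schmidt norm and $\sigma_{n+1}(A_\xi)<\sigma_n(A_\xi)$ for all $\xi\in\Xi$, then there exists a map $\Xi\ni\xi\mapsto A_\xi^n\in\mathcal{S}_2(H_1,H_2)$, continuous with respect to the Hilbert-Schmidt norm, such that, for every $\xi\in\Xi$, the operator $A_\xi^n$ is an optimal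 $n$-rank approximation of $A_\xi$ in both the operator and the Hilbert-Schmidt norms; and if, additionally, $(\Xi,d_\Xi)$ is contractible to a point, then, for $i=1,\dots,n$, there exist continuous maps $\tilde u_i:\Xi\to H_1$ and $v_i:\Xi\to H_2$ such that, for every $\xi\in\Xi$, one has $\langle v_i(\xi),v_j(\xi)\rangle_{H_2}=\delta_{i,j}$ for all $i,j=1,\dots,n$ and $A_\xi^n=\sum_{i=1}^n\langle\cdot,\tilde u_i(\xi)\rangle_{H_1}v_i(\xi)$.
   Context: $\mathcal{K}(H_1,H_2)$ is the space of compact linear operators from $H_1$ to $H_2$ with operator norm $\|\cdot\|_{op}$. For $A\in\mathcal{K}(H_1,H_2)$ and $n\ge1$, $\sigma_n(A):=\inf\{\|A-L\|_{op}:L\in\mathcal{K}(H_1,H_2),\ \operatorname{rank}(L)\le n-1\}$ is the $n$-th singular value. The Hilbert-Schmidt norm is $\|A\|_{HS}:=\left(\sum_{i\ge1}\sigma_i(A)^2\right)^{1/2}$ (value $+\infty$ if the series diverges), and $\mathcal{S}_2(H_1,H_2)$ is the set of $A\in\mathcal{K}(H_1,H_2)$ with $\|A\|_{HS}<\infty$. An operator $M$ with $\operatorname{rank}(M)\le n$ is an optimal $n$-rank approximation of $A$ in a norm $\|\cdot\|_\star$ if $\|A-M\|_\star=\inf\{\|A-L\|_\star:L\in\mathcal{K}(H_1,H_2),\ \operatorname{rank}(L)\le n\}$. Inner products are linear in the first argument, and $\langle\cdot,u\rangle v$ denotes the operator $x\mapsto\langle x,u\rangle v$. *)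

theory Defs
  imports "HOL-Analysis.Analysis" "Jordan_Normal_Form.Conjugate"
begin

text \<open>The scalar field of the Hilbert spaces: the real or the complex numbers, treated uniformly.
  Up to isomorphism these two are the only instances, by the Gelfand-Mazur theorem.\<close>

class rc_field = real_normed_field + conjugatable_field +
  assumes mult_conjugate_eq_norm: "x * conjugate x = (norm x)\<^sup>2 *\<^sub>R 1"

instance real :: rc_field
  by standard (simp add: power2_eq_square)

instance complex :: rc_field
  by standard (simp add: complex_norm_square[symmetric] scaleR_conv_of_real del: of_real_power)

text \<open>Completeness is part of the sort \<open>banach\<close>; the axioms say that the norm of the type is the one
  induced by the inner product, which is linear in its first argument.\<close>

locale hilbert_space = vector_space scale
  for scale :: "'k::rc_field \<Rightarrow> 'a::banach \<Rightarrow> 'a" +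
  fixes ip :: "'a \<Rightarrow> 'a \<Rightarrow> 'k"
  assumes scale_of_real: "scale (of_real r) x = r *\<^sub>R x"
    and ip_add_left: "ip (x + y) z = ip x z + ip y z"
    and ip_scale_left: "ip (scale c x) y = c * ip x y"
    and ip_commute: "ip y x = conjugate (ip x y)"
    and ip_self: "ip x x = of_real ((norm x)\<^sup>2)"

lemma hilbert_space_real:
  "hilbert_space scaleR (inner :: 'a::{real_inner,banach} \<Rightarrow> 'a \<Rightarrow> real)"
  by unfold_locales
    (auto simp: inner_add_left inner_commute power2_norm_eq_inner algebra_simps)

lemma hilbert_space_complex: "hilbert_space (*) (\<lambda>x y::complex. x * cnj y)"
  by unfold_locales
    (auto simp: algebra_simps scaleR_conv_of_real complex_norm_square simp del: of_real_power)

text \<open>Since \<open>vector_space.dim\<close> is a natural number with a junk value on infinite-dimensional spaces,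
  the rank is infinite unless the range lies in the span of a finite set. Below, \<open>s1\<close> and \<open>s2\<close> are
  the scalar multiplications of the domain and of the codomain.\<close>

definition op_rank ::
  "('k::rc_field \<Rightarrow> 'b \<Rightarrow> 'b) \<Rightarrow> ('a::real_normed_vector \<Rightarrow>\<^sub>L 'b::real_normed_vector) \<Rightarrow> enat" where
  "op_rank s2 L =
     (if \<exists>B. finite B \<and> range (blinfun_apply L) \<subseteq> module.span s2 B
      then enat (vector_space.dim s2 (range (blinfun_apply L))) else \<infinity>)"

text \<open>Elements of the type \<open>'a \<Rightarrow>\<^sub>L 'b\<close> are only real-linear, so linearity over the scalar field is
  required explicitly. The norm of this type is the operator norm.\<close>

definition compact_ops ::
  "('k::rc_field \<Rightarrow> 'a \<Rightarrow> 'a) \<Rightarrow> ('k \<Rightarrow> 'b \<Rightarrow> 'b)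
    \<Rightarrow> ('a::real_normed_vector \<Rightarrow>\<^sub>L 'b::real_normed_vector) set" where
  "compact_ops s1 s2 =
     {A. Vector_Spaces.linear s1 s2 (blinfun_apply A) \<and>
         (\<forall>S. bounded S \<longrightarrow> compact (closure (blinfun_apply A ` S)))}"

definition compact_ops_rank_le ::
  "('k::rc_field \<Rightarrow> 'a \<Rightarrow> 'a) \<Rightarrow> ('k \<Rightarrow> 'b \<Rightarrow> 'b) \<Rightarrow> nat
    \<Rightarrow> ('a::real_normed_vector \<Rightarrow>\<^sub>L 'b::real_normed_vector) set" where
  "compact_ops_rank_le s1 s2 n = {L \<in> compact_ops s1 s2. op_rank s2 L \<le> enat n}"

text \<open>Singular values are indexed from \<open>1\<close>; the value at \<open>0\<close> is irrelevant.\<close>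

definition sing_val ::
  "('k::rc_field \<Rightarrow> 'a \<Rightarrow> 'a) \<Rightarrow> ('k \<Rightarrow> 'b \<Rightarrow> 'b) \<Rightarrow> nat
    \<Rightarrow> ('a::real_normed_vector \<Rightarrow>\<^sub>L 'b::real_normed_vector) \<Rightarrow> real" where
  "sing_val s1 s2 n A = (INF L \<in> compact_ops_rank_le s1 s2 (n - 1). norm (A - L))"

definition hs_norm ::
  "('k::rc_field \<Rightarrow> 'a \<Rightarrow> 'a) \<Rightarrow> ('k \<Rightarrow> 'b \<Rightarrow> 'b)
    \<Rightarrow> ('a::real_normed_vector \<Rightarrow>\<^sub>L 'b::real_normed_vector) \<Rightarrow> ereal" where
  "hs_norm s1 s2 A =
     (if summable (\<lambda>i. (sing_val s1 s2 (Suc i) A)\<^sup>2)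
      then ereal (sqrt (\<Sum>i. (sing_val s1 s2 (Suc i) A)\<^sup>2)) else \<infinity>)"

definition hs_ops ::
  "('k::rc_field \<Rightarrow> 'a \<Rightarrow> 'a) \<Rightarrow> ('k \<Rightarrow> 'b \<Rightarrow> 'b)
    \<Rightarrow> ('a::real_normed_vector \<Rightarrow>\<^sub>L 'b::real_normed_vector) set" where
  "hs_ops s1 s2 = {A \<in> compact_ops s1 s2. hs_norm s1 s2 A < \<infinity>}"

definition hs_continuous_on ::
  "('k::rc_field \<Rightarrow> 'a \<Rightarrow> 'a) \<Rightarrow> ('k \<Rightarrow> 'b \<Rightarrow> 'b) \<Rightarrow> 'x::metric_space set
    \<Rightarrow> ('x \<Rightarrow> 'a::real_normed_vector \<Rightarrow>\<^sub>L 'b::real_normed_vector) \<Rightarrow> bool" where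
  "hs_continuous_on s1 s2 X A \<longleftrightarrow>
     (\<forall>x\<in>X. \<forall>e>0. \<exists>d>0. \<forall>y\<in>X. dist y x < d \<longrightarrow> hs_norm s1 s2 (A y - A x) < ereal e)"

text \<open>The norm \<open>N\<close> is a parameter: it is used with the real-valued operator norm and with the
  extended-real-valued Hilbert-Schmidt norm.\<close>

definition optimal_rank_approx ::
  "('k::rc_field \<Rightarrow> 'a \<Rightarrow> 'a) \<Rightarrow> ('k \<Rightarrow> 'b \<Rightarrow> 'b)
    \<Rightarrow> (('a::real_normed_vector \<Rightarrow>\<^sub>L 'b::real_normed_vector) \<Rightarrow> 'c::Inf)
    \<Rightarrow> nat \<Rightarrow> ('a \<Rightarrow>\<^sub>L 'b) \<Rightarrow> ('a \<Rightarrow>\<^sub>L 'b) \<Rightarrow> bool" where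
  "optimal_rank_approx s1 s2 N n A M \<longleftrightarrow>
     M \<in> compact_ops_rank_le s1 s2 n \<and>
     N (A - M) = (INF L \<in> compact_ops_rank_le s1 s2 n. N (A - L))"

text \<open>\<open>ip1\<close> is the inner product of the domain, \<open>ip2\<close> that of the codomain.\<close>

definition continuous_orthonormal_factorization ::
  "('a \<Rightarrow> 'a \<Rightarrow> 'k::rc_field) \<Rightarrow> ('k \<Rightarrow> 'b \<Rightarrow> 'b) \<Rightarrow> ('b \<Rightarrow> 'b \<Rightarrow> 'k) \<Rightarrow> nat \<Rightarrow> 'x::metric_space set
    \<Rightarrow> ('x \<Rightarrow> 'a::real_normed_vector \<Rightarrow>\<^sub>L 'b::real_normed_vector) \<Rightarrow> bool" where
  "continuous_orthonormal_factorization ip1 s2 ip2 n X M \<longleftrightarrow>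
     (\<exists>(u :: nat \<Rightarrow> 'x \<Rightarrow> 'a) (v :: nat \<Rightarrow> 'x \<Rightarrow> 'b).
        (\<forall>i\<in>{1..n}. continuous_on X (u i) \<and> continuous_on X (v i)) \<and>
        (\<forall>\<xi>\<in>X.
           (\<forall>i\<in>{1..n}. \<forall>j\<in>{1..n}. ip2 (v i \<xi>) (v j \<xi>) = (if i = j then 1 else 0)) \<and>
           (\<forall>x. blinfun_apply (M \<xi>) x = (\<Sum>i=1..n. s2 (ip1 x (u i \<xi>)) (v i \<xi>)))))"

end

theory Submission
  imports Defs
begin

text \<open>A compact operator attains its norm, and splitting off the maximiser repeatedly gives singular
  vectors \<open>u 0, u 1, \<dots>\<close> with \<open>\<sigma> (Suc i) A = norm (A (u i))\<close>. Truncating after \<open>n\<close> steps leaves an operator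
  whose \<open>i\<close>-th singular value is \<open>\<sigma> (i + n) A\<close>, and no operator of rank \<open>n\<close> can lower any singular value
  further; this is optimality in both norms. If \<open>\<sigma> (n + 1) A < \<sigma> n A\<close>, any orthonormal
  \<open>n\<close>-frame capturing almost the energy \<open>\<Sum>i<n. (norm (A (u i)))\<^sup>2\<close> is close to the span of the \<open>u i\<close>;
  the singular vectors of a nearby operator form such a frame, hence the truncation is continuous in the
  operator norm. Differences of truncations have rank at most \<open>2 * n\<close>, so continuity in the Hilbert-Schmidt
  norm is automatic. On a contractible compact space an orthonormal frame of the ranges is obtained by
  transporting a constant frame along the contraction in small steps, projecting and
  re-orthonormalising at each step.\<close>

section \<open>Orthonormal systems and projections\<close>

text \<open>Individual singular vectors cannot in general be followed continuously: where singular
  values coincide or cross, the \<open>u i\<close> are arbitrary, and here they are chosen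
  separately at each point. The gap at \<open>n\<close> controls only their joint span, so all
  continuity is carried by projections \<open>proj n u\<close>, and the \<open>v i\<close> of the
  factorization are in general not singular vectors. They form a frame of the bundle of ranges,
  which has constant dimension \<open>n\<close> because the gap forces
  \<open>\<sigma> n A > 0\<close>. The other factor is then dictated: it is the image of
  \<open>v i\<close> under the adjoint of the approximation and need not be orthogonal. Adjoints
  occur only in weak form. That \<open>u i\<close> is an eigenvector of the adjoint of
  \<open>A\<close> composed with \<open>A\<close> is the first-order condition of norm maximisation,
  tested against every vector. The gap between the squares of the two singular values measures how
  fast the energy drops when a frame leaves the span of the maximisers; this is where the
  denominators in the continuity bounds come from.\<close>

lemma mult_conjugate: "x * conjugate x = of_real ((norm x)\<^sup>2)" for x :: "'k::rc_field"
  using mult_conjugate_eq_norm[of x] by (simp only: of_real_def)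

lemma conjugate_of_real [simp]: "conjugate (of_real r :: 'k::rc_field) = of_real r"
proof (cases "r = 0")
  case False
  have "of_real r * conjugate (of_real r :: 'k) = of_real r * of_real r"
    by (simp add: mult_conjugate power2_eq_square flip: of_real_mult)
  then show ?thesis using False by simp
qed simp

lemma norm_conjugate [simp]: "norm (conjugate x) = norm x" for x :: "'k::rc_field"
proof (cases "x = 0")
  case False
  have "norm x * norm (conjugate x) = norm x * norm x"
    by (simp add: mult_conjugate power2_eq_square flip: norm_mult)
  then show ?thesis using False by simp
qed simp

lemma conjugate_dist_diff: "conjugate (x - y) = conjugate x - conjugate y" for x y :: "'k::rc_field"
  using conjugate_dist_add[of x "- y"] by (simp add: conjugate_neg)

text \<open>Cauchy-Schwarz with the square sum of one factor replaced by a bound. Bessel's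
  inequality supplies that bound when a combination of residual vectors is estimated.\<close>

lemma norm_sum_mult_le:
  assumes "\<And>k. k < n \<Longrightarrow> norm (y k) \<le> a k * b k" "(\<Sum>k<n. (a k)\<^sup>2) \<le> A\<^sup>2" "A \<ge> 0"
  shows "norm (\<Sum>k<n. y k) \<le> A * sqrt (\<Sum>k<n. (b k)\<^sup>2)"
proof -
  have "norm (\<Sum>k<n. y k) \<le> (\<Sum>k<n. norm (y k))" by (rule norm_sum)
  also have "\<dots> \<le> (\<Sum>k<n. \<bar>a k\<bar> * \<bar>b k\<bar>)"
    by (intro sum_mono) (use assms(1) in \<open>force simp flip: abs_mult intro: order_trans\<close>)
  also have "\<dots> \<le> L2_set a {..<n} * L2_set b {..<n}"
    by (rule L2_set_mult_ineq)
  also have "\<dots> \<le> A * L2_set b {..<n}"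
    by (intro mult_right_mono) (use assms real_le_lsqrt in \<open>auto simp: L2_set_def sum_nonneg\<close>)
  finally show ?thesis by (simp add: L2_set_def)
qed

section \<open>Inner product calculus over the abstract scalar field\<close>

context hilbert_space
begin

lemma ip_add_right: "ip x (y + z) = ip x y + ip x z"
  by (metis conjugate_dist_add ip_add_left ip_commute)

lemma ip_scale_right: "ip x (scale c y) = conjugate c * ip x y"
  by (metis conjugate_dist_mul ip_commute ip_scale_left)

lemma ip_zero_left [simp]: "ip 0 x = 0"
  using ip_add_left[of 0 0 x] by simp

lemma ip_zero_right [simp]: "ip x 0 = 0"
  using ip_add_right[of x 0 0] by simp

lemma ip_minus_left: "ip (- x) y = - ip x y"
  using ip_add_left[of x "- x" y] by (simp add: eq_neg_iff_add_eq_0 add.commute)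

lemma ip_minus_right: "ip x (- y) = - ip x y"
  using ip_add_right[of x y "- y"] by (simp add: eq_neg_iff_add_eq_0 add.commute)

lemma ip_diff_left: "ip (x - y) z = ip x z - ip y z"
  using ip_add_left[of x "- y" z] by (simp add: ip_minus_left)

lemma ip_diff_right: "ip x (y - z) = ip x y - ip x z"
  using ip_add_right[of x y "- z"] by (simp add: ip_minus_right)

lemma ip_sum_left: "ip (sum f S) y = (\<Sum>i\<in>S. ip (f i) y)"
  by (induction S rule: infinite_finite_induct) (auto simp: ip_add_left)

lemma ip_sum_right: "ip x (sum f S) = (\<Sum>i\<in>S. ip x (f i))"
  by (induction S rule: infinite_finite_induct) (auto simp: ip_add_right)

lemma ip_zero_swap: "ip x y = 0 \<Longrightarrow> ip y x = 0"
  by (simp add: ip_commute[of x y])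

text \<open>The axioms link \<open>scale\<close> to the norm directly only for real scalars; for the
  others homogeneity comes from \<open>ip_self\<close> and \<open>c * conjugate c\<close>.\<close>

lemma norm_scale: "norm (scale c x) = norm c * norm x"
proof -
  have "of_real ((norm (scale c x))\<^sup>2) = (c * conjugate c) * ip x x"
    by (simp add: ip_scale_left ip_scale_right ip_self[symmetric] del: of_real_power)
  also have "\<dots> = of_real ((norm c * norm x)\<^sup>2)"
    by (simp only: mult_conjugate ip_self of_real_mult power_mult_distrib)
  finally have "(norm (scale c x))\<^sup>2 = (norm c * norm x)\<^sup>2"
    by (simp only: of_real_eq_iff)
  then show ?thesis by simp
qed

text \<open>Twice the real part of the inner product is written as the scalar plus its conjugate,
  and the identity lives in \<open>'k\<close>; \<open>of_real_eq_iff\<close> returns to the reals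
  once these terms have cancelled.\<close>

lemma norm_add_square:
  "of_real ((norm (x + y))\<^sup>2) =
     of_real ((norm x)\<^sup>2 + (norm y)\<^sup>2) + (ip x y + conjugate (ip x y))"
  by (simp add: ip_add_left ip_add_right ip_commute[of y x] ip_self[symmetric] del: of_real_power)

lemma pythagoras: "ip x y = 0 \<Longrightarrow> (norm (x + y))\<^sup>2 = (norm x)\<^sup>2 + (norm y)\<^sup>2"
  using norm_add_square[of x y] by (simp only: conjugate_zero add_0_right of_real_eq_iff)

lemma parallelogram:
  fixes x y :: 'a
  shows "(norm (x + y))\<^sup>2 + (norm (x - y))\<^sup>2 = 2 * (norm x)\<^sup>2 + 2 * (norm y)\<^sup>2"
proof -
  have "of_real ((norm (x + y))\<^sup>2 + (norm (x - y))\<^sup>2)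
      = (of_real (2 * (norm x)\<^sup>2 + 2 * (norm y)\<^sup>2) :: 'k)"
    using norm_add_square[of x y] norm_add_square[of x "- y"]
    by (simp add: ip_minus_right conjugate_neg del: of_real_power)
  then show ?thesis by (simp only: of_real_eq_iff)
qed

text \<open>Pythagoras for \<open>x = (x - scale c y) + scale c y\<close>, where \<open>c\<close> is
  the coefficient of the orthogonal projection of \<open>x\<close> to the line through
  \<open>y\<close>.\<close>

lemma norm_ip_le: "norm (ip x y) \<le> norm x * norm y"
proof (cases "y = 0")
  case False
  define c where "c = ip x y * of_real (inverse ((norm y)\<^sup>2))"
  have cy: "c * ip y y = ip x y"
    using False by (simp add: c_def ip_self flip: of_real_mult of_real_power of_real_inverse)
  have "ip (x - scale c y) (scale c y) = 0"
    by (simp add: ip_diff_left ip_scale_left ip_scale_right cy)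
  from pythagoras[OF this] have "(norm (scale c y))\<^sup>2 \<le> (norm x)\<^sup>2"
    by simp
  then have "norm c * norm y \<le> norm x"
    by (simp add: norm_scale power2_le_iff_abs_le)
  then have "norm c * norm y * norm y \<le> norm x * norm y"
    by (rule mult_right_mono) simp
  moreover have "norm (ip x y) = norm c * (norm y * norm y)"
    by (metis cy norm_mult ip_self norm_of_real abs_of_nonneg power2_eq_square zero_le_power2)
  ultimately show ?thesis by simp
qed simp

lemma scaleR_eq_scale: "r *\<^sub>R x = scale (of_real r) x"
  by (simp add: scale_of_real)

lemma bounded_bilinear_scale: "bounded_bilinear scale"
proof
  show "\<exists>K. \<forall>a b. norm (scale a b) \<le> norm a * norm b * K"
    by (rule exI[of _ 1]) (simp add: norm_scale)
qed (simp_all add: scale_left_distrib scale_right_distrib scaleR_eq_scale scaleR_conv_of_real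
       mult.commute)

lemma bounded_bilinear_ip: "bounded_bilinear ip"
proof
  show "\<exists>K. \<forall>a b. norm (ip a b) \<le> norm a * norm b * K"
    by (rule exI[of _ 1]) (simp add: norm_ip_le)
qed (simp_all add: ip_add_left ip_add_right ip_scale_left ip_scale_right scaleR_eq_scale
       scaleR_conv_of_real)

lemmas continuous_on_scale = bounded_bilinear.continuous_on[OF bounded_bilinear_scale]
lemmas continuous_on_ip = bounded_bilinear.continuous_on[OF bounded_bilinear_ip]

text \<open>A frame is a total function of which only the first \<open>n\<close> values count:
  extending it is a function update, and shortening it changes only \<open>n\<close>.\<close>

definition orthonormal :: "nat \<Rightarrow> (nat \<Rightarrow> 'a) \<Rightarrow> bool" where
  "orthonormal n e \<longleftrightarrow> (\<forall>i<n. \<forall>j<n. ip (e i) (e j) = (if i = j then 1 else 0))"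

lemma orthonormalD: "orthonormal n e \<Longrightarrow> i < n \<Longrightarrow> j < n \<Longrightarrow> ip (e i) (e j) = (if i = j then 1 else 0)"
  by (simp add: orthonormal_def)

lemma orthonormal_norm: "orthonormal n e \<Longrightarrow> i < n \<Longrightarrow> norm (e i) = 1"
proof -
  assume "orthonormal n e" "i < n"
  then have "of_real ((norm (e i))\<^sup>2) = (of_real 1 :: 'k)"
    using ip_self[of "e i"] by (simp add: orthonormalD)
  then have "(norm (e i))\<^sup>2 = 1\<^sup>2" by (simp only: of_real_eq_iff one_power2)
  then show "norm (e i) = 1" by (rule power2_eq_imp_eq) auto
qed

lemma orthonormal_mono: "orthonormal n e \<Longrightarrow> m \<le> n \<Longrightarrow> orthonormal m e"
  by (auto simp: orthonormal_def)

lemma ip_orthonormal_sum: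
  assumes "orthonormal n e" "j < n"
  shows "ip (\<Sum>i<n. scale (c i) (e i)) (e j) = c j"
proof -
  have "ip (\<Sum>i<n. scale (c i) (e i)) (e j) = (\<Sum>i<n. if i = j then c i else 0)"
    unfolding ip_sum_left
    by (rule sum.cong) (use assms in \<open>auto simp: ip_scale_left orthonormalD\<close>)
  then show ?thesis using assms by (simp add: sum.delta)
qed

lemma norm_orthogonal_sum:
  assumes "finite S" "\<And>i j. i \<in> S \<Longrightarrow> j \<in> S \<Longrightarrow> i \<noteq> j \<Longrightarrow> ip (f i) (f j) = 0"
  shows "(norm (sum f S))\<^sup>2 = (\<Sum>i\<in>S. (norm (f i))\<^sup>2)"
  using assms
proof (induction S)
  case (insert a S)
  have "ip (f a) (sum f S) = 0"
    unfolding ip_sum_right by (rule sum.neutral) (use insert in auto)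
  then show ?case using insert by (simp add: pythagoras)
qed simp

lemma norm_orthonormal_sum:
  assumes "orthonormal n e"
  shows "(norm (\<Sum>i<n. scale (c i) (e i)))\<^sup>2 = (\<Sum>i<n. (norm (c i))\<^sup>2)"
proof -
  have "(norm (\<Sum>i<n. scale (c i) (e i)))\<^sup>2 = (\<Sum>i<n. (norm (scale (c i) (e i)))\<^sup>2)"
    by (rule norm_orthogonal_sum)
       (use assms in \<open>auto simp: ip_scale_left ip_scale_right orthonormalD\<close>)
  also have "\<dots> = (\<Sum>i<n. (norm (c i))\<^sup>2)"
    by (rule sum.cong) (use assms in \<open>auto simp: norm_scale orthonormal_norm\<close>)
  finally show ?thesis .
qed

text \<open>An orthogonal projection only when \<open>e\<close> is orthonormal. Subspaces never
  appear as such: two frames are compared through the operator norm of the difference of their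
  \<open>proj\<close>, and equality of \<open>proj\<close> expresses that they span the same
  space.\<close>

definition proj :: "nat \<Rightarrow> (nat \<Rightarrow> 'a) \<Rightarrow> 'a \<Rightarrow>\<^sub>L 'a" where
  "proj n e = Blinfun (\<lambda>x. \<Sum>i<n. scale (ip x (e i)) (e i))"

lemma proj_apply: "blinfun_apply (proj n e) x = (\<Sum>i<n. scale (ip x (e i)) (e i))"
proof -
  have "bounded_linear (\<lambda>x. \<Sum>i<n. scale (ip x (e i)) (e i))"
    by (intro bounded_linear_sum bounded_linear_compose[OF
          bounded_bilinear.bounded_linear_left[OF bounded_bilinear_scale]
          bounded_bilinear.bounded_linear_left[OF bounded_bilinear_ip]])
  then show ?thesis unfolding proj_def by (simp add: bounded_linear_Blinfun_apply)
qed

lemma proj_scale: "proj n e (scale c x) = scale c (proj n e x)"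
  by (simp add: proj_apply ip_scale_left scale_sum_right)

lemma proj_in_span: "proj n e x \<in> span (e ` {..<n})"
  unfolding proj_apply by (intro span_sum span_scale span_base) auto

lemma ip_proj: "orthonormal n e \<Longrightarrow> j < n \<Longrightarrow> ip (proj n e x) (e j) = ip x (e j)"
  by (simp add: proj_apply ip_orthonormal_sum[of n e j "\<lambda>i. ip x (e i)"])

lemma ip_residual: "orthonormal n e \<Longrightarrow> j < n \<Longrightarrow> ip (x - proj n e x) (e j) = 0"
  by (simp add: ip_diff_left ip_proj)

lemma proj_self: "orthonormal n e \<Longrightarrow> j < n \<Longrightarrow> proj n e (e j) = e j"
proof -
  assume "orthonormal n e" "j < n"
  then have "proj n e (e j) = (\<Sum>i<n. if i = j then e i else 0)"
    unfolding proj_apply by (intro sum.cong) (auto simp: orthonormalD)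
  then show "proj n e (e j) = e j" using \<open>j < n\<close> by simp
qed

lemma proj_eq_self:
  assumes "orthonormal n e" "x \<in> span (e ` {..<n})"
  shows "proj n e x = x"
  using assms(2)
  by (induction rule: span_induct_alt)
     (use assms(1) in \<open>auto simp: blinfun.add_right proj_scale proj_self\<close>)

lemma norm_proj_square: "orthonormal n e \<Longrightarrow> (norm (proj n e x))\<^sup>2 = (\<Sum>i<n. (norm (ip x (e i)))\<^sup>2)"
  by (simp add: proj_apply norm_orthonormal_sum)

lemma proj_pythagoras:
  assumes "orthonormal n e"
  shows "(norm x)\<^sup>2 = (norm (proj n e x))\<^sup>2 + (norm (x - proj n e x))\<^sup>2"
proof -
  have "ip (x - proj n e x) (proj n e x) = 0"
    by (subst (2) proj_apply)
       (use assms in \<open>auto simp: ip_sum_right ip_scale_right ip_residual intro!: sum.neutral\<close>)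
  from pythagoras[OF this] show ?thesis by simp
qed

lemma norm_proj_le: "orthonormal n e \<Longrightarrow> norm (proj n e x) \<le> norm x"
  using proj_pythagoras[of n e x] by (simp add: power2_le_imp_le)

lemma norm_residual_le: "orthonormal n e \<Longrightarrow> norm (x - proj n e x) \<le> norm x"
  using proj_pythagoras[of n e x] by (simp add: power2_le_imp_le)

lemma bessel: "orthonormal n e \<Longrightarrow> (\<Sum>i<n. (norm (ip x (e i)))\<^sup>2) \<le> (norm x)\<^sup>2"
  using proj_pythagoras[of n e x] by (simp flip: norm_proj_square)

section \<open>Distance between two projections of equal rank\<close>

lemma norm_ip_commute: "norm (ip x y) = norm (ip y x)"
  by (simp add: ip_commute[of x y])

text \<open>Both sides equal \<open>n\<close> minus the sum of all squared overlaps between the two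
  frames, that is \<open>n\<close> minus the trace of the product of the projections, which is
  symmetric.\<close>

lemma residual_sum_commute:
  assumes e: "orthonormal n e" and f: "orthonormal n f"
  shows "(\<Sum>k<n. (norm (f k - proj n e (f k)))\<^sup>2) = (\<Sum>k<n. (norm (e k - proj n f (e k)))\<^sup>2)"
proof -
  have 1: "(\<Sum>k<n. (norm (f k - proj n e (f k)))\<^sup>2) = real n - (\<Sum>k<n. \<Sum>i<n. (norm (ip (f k) (e i)))\<^sup>2)"
    if e: "orthonormal n e" and f: "orthonormal n f" for e f
  proof -
    have "(norm (f k - proj n e (f k)))\<^sup>2 = 1 - (\<Sum>i<n. (norm (ip (f k) (e i)))\<^sup>2)" if "k < n" for k
      using proj_pythagoras[OF e, of "f k"] orthonormal_norm[OF f that]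
      by (simp add: norm_proj_square[OF e])
    then have "(\<Sum>k<n. (norm (f k - proj n e (f k)))\<^sup>2) = (\<Sum>k<n. 1 - (\<Sum>i<n. (norm (ip (f k) (e i)))\<^sup>2))"
      by (intro sum.cong) auto
    then show ?thesis by (simp add: sum_subtractf)
  qed
  show ?thesis unfolding 1[OF e f] 1[OF f e]
    by (subst sum.swap) (simp add: norm_ip_commute[of "e _"])
qed

text \<open>With P and Q the two projections, P - Q = P(1 - Q) - (1 - P)Q. The second term is a
  combination of residuals of the \<open>f k\<close>. The first one pairs \<open>x - ?Q x\<close>
  with \<open>e i\<close>, which may be replaced by its residual because \<open>x - ?Q x\<close> is
  orthogonal to the range of Q; \<open>residual_sum_commute\<close> turns these residuals into those
  of \<open>f\<close>. The factor 2 counts the two terms.\<close>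

lemma proj_diff_le:
  assumes e: "orthonormal n e" and f: "orthonormal n f"
  shows "norm (proj n e - proj n f) \<le> 2 * sqrt (\<Sum>k<n. (norm (f k - proj n e (f k)))\<^sup>2)"
    (is "_ \<le> 2 * ?d")
proof (rule norm_blinfun_bound)
  show "0 \<le> 2 * ?d" by (simp add: sum_nonneg)
  fix x
  let ?P = "proj n e" and ?Q = "proj n f"
  have "norm (?P (x - ?Q x)) \<le> norm x * ?d"
  proof (rule power2_le_imp_le)
    have "(norm (?P (x - ?Q x)))\<^sup>2 = (\<Sum>i<n. (norm (ip (x - ?Q x) (e i - ?Q (e i))))\<^sup>2)"
      unfolding norm_proj_square[OF e]
    proof (intro sum.cong refl)
      fix i
      have "ip (x - ?Q x) (?Q (e i)) = 0"
        by (subst (2) proj_apply)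
           (auto simp: ip_sum_right ip_scale_right ip_residual[OF f] intro!: sum.neutral)
      then show "(norm (ip (x - ?Q x) (e i)))\<^sup>2 = (norm (ip (x - ?Q x) (e i - ?Q (e i))))\<^sup>2"
        by (simp add: ip_diff_right)
    qed
    also have "\<dots> \<le> (\<Sum>i<n. (norm x * norm (e i - ?Q (e i)))\<^sup>2)"
      by (intro sum_mono power_mono order_trans[OF norm_ip_le] mult_right_mono norm_residual_le f) auto
    also have "\<dots> = (norm x * ?d)\<^sup>2"
      by (simp add: power_mult_distrib residual_sum_commute[OF e f] sum_nonneg flip: sum_distrib_left)
    finally show "(norm (?P (x - ?Q x)))\<^sup>2 \<le> (norm x * ?d)\<^sup>2" .
  qed (simp add: sum_nonneg)
  moreover have "norm (?Q x - ?P (?Q x)) \<le> norm x * ?d"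
  proof -
    have "?Q x - ?P (?Q x) = (\<Sum>k<n. scale (ip x (f k)) (f k - ?P (f k)))"
      unfolding proj_apply[of n f x]
      by (simp add: blinfun.sum_right proj_scale scale_right_diff_distrib sum_subtractf)
    then show ?thesis
      by (simp only:) (rule norm_sum_mult_le[where a = "\<lambda>k. norm (ip x (f k))"],
        auto simp: norm_scale bessel[OF f])
  qed
  moreover have "(?P - ?Q) x = ?P (x - ?Q x) - (?Q x - ?P (?Q x))"
    by (simp add: blinfun.diff_left blinfun.diff_right)
  ultimately show "norm ((?P - ?Q) x) \<le> 2 * ?d * norm x"
    using norm_triangle_ineq4[of "?P (x - ?Q x)" "?Q x - ?P (?Q x)"] by (simp add: mult.commute)
qed

text \<open>Stated for the indexed family and not for its image set, since different indices may
  carry the same vector; such a coincidence gives the coefficients 1 and -1.\<close>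

lemma exists_dependency:
  assumes "finite B" "card B < m" "\<And>k. k < m \<Longrightarrow> f k \<in> span B"
  obtains c where "\<exists>k<m. c k \<noteq> 0" "(\<Sum>k<m. scale (c k) (f k)) = 0"
proof (cases "inj_on f {..<m}")
  case True
  have "\<not> independent (f ` {..<m})"
  proof
    assume "independent (f ` {..<m})"
    then have "card (f ` {..<m}) \<le> card B"
      using independent_span_bound[of B "f ` {..<m}"] assms by blast
    then show False using True assms by (simp add: card_image)
  qed
  then obtain c where "\<exists>v\<in>f ` {..<m}. c v \<noteq> 0" "(\<Sum>v\<in>f ` {..<m}. scale (c v) v) = 0"
    by (auto simp: dependent_finite)
  then show ?thesis
    by (intro that[of "c \<circ> f"]) (auto simp: sum.reindex[OF True])
next
  case False
  then obtain i j where ij: "i < m" "j < m" "i \<noteq> j" "f i = f j" by (auto simp: inj_on_def)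
  define c :: "nat \<Rightarrow> 'k" where "c k = (if k = i then 1 else if k = j then - 1 else 0)" for k
  have "(\<Sum>k<m. scale (c k) (f k)) = (\<Sum>k\<in>{i, j}. scale (c k) (f k))"
    by (rule sum.mono_neutral_right) (use ij in \<open>auto simp: c_def\<close>)
  then show ?thesis using ij by (intro that[of c]) (auto simp: c_def)
qed

end

section \<open>Continuous frames over contractible spaces\<close>

context hilbert_space
begin

text \<open>The only discontinuous operation in Gram-Schmidt is the division by the norm of the
  residual, and pointwise independence keeps that norm away from zero. Independence is phrased
  through predecessors because this is exactly what the induction consumes.\<close>

lemma gram_schmidt_continuous:
  fixes w :: "nat \<Rightarrow> 'x::topological_space \<Rightarrow> 'a"
  assumes "\<And>i. i < n \<Longrightarrow> continuous_on X (w i)"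
    and "\<And>\<xi> i. \<xi> \<in> X \<Longrightarrow> i < n \<Longrightarrow> w i \<xi> \<notin> span ((\<lambda>j. w j \<xi>) ` {..<i})"
  shows "\<exists>v. (\<forall>i<n. continuous_on X (v i)) \<and>
    (\<forall>\<xi>\<in>X. orthonormal n (\<lambda>i. v i \<xi>) \<and> (\<forall>i<n. v i \<xi> \<in> span ((\<lambda>j. w j \<xi>) ` {..<n})))"
  using assms
proof (induction n)
  case 0
  then show ?case by (simp add: orthonormal_def)
next
  case (Suc n)
  then obtain v where cont: "\<And>i. i < n \<Longrightarrow> continuous_on X (v i)"
    and on: "\<And>\<xi>. \<xi> \<in> X \<Longrightarrow> orthonormal n (\<lambda>i. v i \<xi>)"
    and sp: "\<And>\<xi> i. \<xi> \<in> X \<Longrightarrow> i < n \<Longrightarrow> v i \<xi> \<in> span ((\<lambda>j. w j \<xi>) ` {..<n})"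
    by (metis less_SucI)
  define r where "r \<xi> = w n \<xi> - proj n (\<lambda>i. v i \<xi>) (w n \<xi>)" for \<xi>
  define x where "x \<xi> = (1 / norm (r \<xi>)) *\<^sub>R r \<xi>" for \<xi>
  have proj_span: "proj n (\<lambda>i. v i \<xi>) (w n \<xi>) \<in> span ((\<lambda>j. w j \<xi>) ` {..<n})" if "\<xi> \<in> X" for \<xi>
    unfolding proj_apply by (intro span_sum span_scale sp that) simp
  have r0: "r \<xi> \<noteq> 0" if "\<xi> \<in> X" for \<xi>
  proof
    assume "r \<xi> = 0"
    then have "w n \<xi> \<in> span ((\<lambda>j. w j \<xi>) ` {..<n})"
      using proj_span[OF that] by (simp add: r_def)
    then show False using Suc.prems(2)[OF that, of n] by simp
  qed
  have "continuous_on X r"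
    unfolding r_def proj_apply
    by (intro continuous_intros continuous_on_scale continuous_on_ip cont Suc.prems(1)) auto
  then have cont_x: "continuous_on X x"
    unfolding x_def using r0 by (intro continuous_intros) auto
  have x_norm: "norm (x \<xi>) = 1" if "\<xi> \<in> X" for \<xi>
    using r0[OF that] by (simp add: x_def)
  have x_orth: "ip (x \<xi>) (v i \<xi>) = 0" if "\<xi> \<in> X" "i < n" for \<xi> i
    using ip_residual[OF on[OF that(1)] that(2)] by (simp add: x_def r_def scaleR_eq_scale ip_scale_left)
  have mono: "span ((\<lambda>j. w j \<xi>) ` {..<n}) \<subseteq> span ((\<lambda>j. w j \<xi>) ` {..<Suc n})" for \<xi>
    by (intro span_mono) auto
  have x_span: "x \<xi> \<in> span ((\<lambda>j. w j \<xi>) ` {..<Suc n})" if "\<xi> \<in> X" for \<xi>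
  proof -
    have "w n \<xi> \<in> span ((\<lambda>j. w j \<xi>) ` {..<Suc n})" by (intro span_base) auto
    then show ?thesis
      unfolding x_def r_def scaleR_eq_scale using proj_span[OF that] mono
      by (intro span_scale span_diff) blast+
  qed
  show ?case
  proof (rule exI[of _ "v(n := x)"], intro conjI allI impI ballI)
    fix i assume "i < Suc n"
    then show "continuous_on X ((v(n := x)) i)"
      using cont cont_x by (auto simp: less_Suc_eq)
  next
    fix \<xi> assume \<xi>: "\<xi> \<in> X"
    have "ip (x \<xi>) (x \<xi>) = 1" by (simp add: ip_self x_norm[OF \<xi>])
    then show "orthonormal (Suc n) (\<lambda>i. (v(n := x)) i \<xi>)"
      using on[OF \<xi>] x_orth[OF \<xi>] ip_zero_swap[OF x_orth[OF \<xi>]]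
      by (auto simp: orthonormal_def less_Suc_eq)
    fix i assume "i < Suc n"
    then show "(v(n := x)) i \<xi> \<in> span ((\<lambda>j. w j \<xi>) ` {..<Suc n})"
      using sp[OF \<xi>] mono[of \<xi>] x_span[OF \<xi>] by (auto simp: less_Suc_eq)
  qed
qed

text \<open>Linear combinations lift coefficientwise; this turns a dependency among projected
  vectors into a vector killed by the projection.\<close>

lemma span_proj_image:
  assumes "y \<in> span ((\<lambda>j. blinfun_apply (proj n f) (e j)) ` S)"
  shows "\<exists>g\<in>span (e ` S). proj n f g = y"
  using assms
proof (induction rule: span_induct_alt)
  case base
  then show ?case using span_zero by (intro bexI[of _ 0]) auto
next
  case (step c x y)
  then obtain j g where "j \<in> S" "x = proj n f (e j)" "g \<in> span (e ` S)" "proj n f g = y"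
    by blast
  then show ?case
    by (intro bexI[of _ "scale c (e j) + g"] span_add span_scale)
       (auto simp: blinfun.add_right proj_scale span_base)
qed

text \<open>A projection at distance less than 1 is injective on the span of \<open>e\<close>: a
  vector \<open>z\<close> there that it kills equals its own image under the difference of the
  projections, so its norm would be strictly smaller than itself unless
  \<open>z = 0\<close>.\<close>

lemma proj_images_independent:
  assumes e: "orthonormal n e" and close: "norm (proj n e - proj n f) < 1" and i: "i < n"
  shows "proj n f (e i) \<notin> span ((\<lambda>j. proj n f (e j)) ` {..<i})"
proof
  assume "proj n f (e i) \<in> span ((\<lambda>j. proj n f (e j)) ` {..<i})"
  then obtain g where g: "g \<in> span (e ` {..<i})" "proj n f g = proj n f (e i)"
    using span_proj_image by blast
  define z where "z = e i - g"
  have "g \<in> span (e ` {..<n})"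
    by (rule subsetD[OF span_mono g(1)]) (use i in auto)
  then have "proj n e z = z"
    unfolding z_def by (intro proj_eq_self[OF e] span_diff) (use i in \<open>auto simp: span_base\<close>)
  moreover have "proj n f z = 0" by (simp add: z_def g(2) blinfun.diff_right)
  ultimately have "norm z \<le> norm (proj n e - proj n f) * norm z"
    using norm_blinfun[of "proj n e - proj n f" z] by (simp add: blinfun.diff_left)
  then have "z = 0"
    using close by (smt (verit) mult_less_cancel_right2 norm_ge_zero norm_eq_zero)
  then have "e i \<in> span (e ` {..<i})" using g(1) by (simp add: z_def)
  then have "proj i e (e i) = e i"
    by (intro proj_eq_self orthonormal_mono[OF e]) (use i in auto)
  moreover have "proj i e (e i) = 0"
    using orthonormalD[OF e] i by (simp add: proj_apply)
  ultimately show False using orthonormal_norm[OF e i] by simp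
qed

text \<open>Only the projections of \<open>f\<close> are continuous, not its vectors. Projecting the
  continuous frame \<open>e\<close> into the ranges given by \<open>f\<close> keeps it independent
  because the projections are close, and Gram-Schmidt restores orthonormality.\<close>

lemma frame_transport_step:
  fixes e :: "nat \<Rightarrow> 'x::topological_space \<Rightarrow> 'a"
  assumes e_cont: "\<And>i. i < n \<Longrightarrow> continuous_on X (e i)"
    and e: "\<And>\<xi>. \<xi> \<in> X \<Longrightarrow> orthonormal n (\<lambda>i. e i \<xi>)"
    and f: "\<And>\<xi>. \<xi> \<in> X \<Longrightarrow> orthonormal n (f \<xi>)"
    and f_cont: "continuous_on X (\<lambda>\<xi>. proj n (f \<xi>))"
    and close: "\<And>\<xi>. \<xi> \<in> X \<Longrightarrow> norm (proj n (\<lambda>i. e i \<xi>) - proj n (f \<xi>)) < 1"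
  shows "\<exists>g. (\<forall>i<n. continuous_on X (g i)) \<and>
    (\<forall>\<xi>\<in>X. orthonormal n (\<lambda>i. g i \<xi>) \<and> proj n (\<lambda>i. g i \<xi>) = proj n (f \<xi>))"
proof -
  define w where "w i \<xi> = proj n (f \<xi>) (e i \<xi>)" for i \<xi>
  have "continuous_on X (w i)" if "i < n" for i
    unfolding w_def by (intro continuous_intros f_cont e_cont that)
  moreover have "w i \<xi> \<notin> span ((\<lambda>j. w j \<xi>) ` {..<i})" if "\<xi> \<in> X" "i < n" for \<xi> i
    unfolding w_def by (rule proj_images_independent[OF e close]) (use that in auto)
  ultimately obtain g where g: "\<And>i. i < n \<Longrightarrow> continuous_on X (g i)"
      "\<And>\<xi>. \<xi> \<in> X \<Longrightarrow> orthonormal n (\<lambda>i. g i \<xi>)"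
      "\<And>\<xi> i. \<xi> \<in> X \<Longrightarrow> i < n \<Longrightarrow> g i \<xi> \<in> span ((\<lambda>j. w j \<xi>) ` {..<n})"
    using gram_schmidt_continuous[of n X w] by metis
  have "proj n (\<lambda>i. g i \<xi>) = proj n (f \<xi>)" if \<xi>: "\<xi> \<in> X" for \<xi>
  proof -
    have "(\<lambda>j. w j \<xi>) ` {..<n} \<subseteq> span (f \<xi> ` {..<n})"
      unfolding w_def using proj_in_span by auto
    then have "span ((\<lambda>j. w j \<xi>) ` {..<n}) \<subseteq> span (f \<xi> ` {..<n})"
      by (intro span_minimal subspace_span)
    then have "proj n (f \<xi>) (g k \<xi>) = g k \<xi>" if "k < n" for k
      using g(3)[OF \<xi> that] by (intro proj_eq_self[OF f[OF \<xi>]]) blast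
    \<comment> \<open>All residuals of \<open>g\<close> with respect to \<open>f \<xi>\<close>
      vanish, so the symmetric distance bound gives equality of the ranges without a dimension
      count.\<close>
    then have "norm (proj n (f \<xi>) - proj n (\<lambda>i. g i \<xi>)) \<le> 0"
      using proj_diff_le[OF f[OF \<xi>] g(2)[OF \<xi>]] by simp
    then show ?thesis by simp
  qed
  then show ?thesis using g by blast
qed

text \<open>A vector bundle over a contractible base is trivial. Compactness enters through uniform
  continuity of \<open>G\<close> on the cylinder: one step size serves all points, and consecutive
  projections are at distance below 1, the threshold for transport.\<close>

lemma contractible_frame:
  fixes f :: "'x::metric_space \<Rightarrow> nat \<Rightarrow> 'a"
  assumes X: "compact X" "contractible X"
    and f: "\<And>\<xi>. \<xi> \<in> X \<Longrightarrow> orthonormal n (f \<xi>)"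
    and cont: "continuous_on X (\<lambda>\<xi>. proj n (f \<xi>))"
  shows "\<exists>v. (\<forall>i<n. continuous_on X (v i)) \<and>
    (\<forall>\<xi>\<in>X. orthonormal n (\<lambda>i. v i \<xi>) \<and> proj n (\<lambda>i. v i \<xi>) = proj n (f \<xi>))"
proof (cases "X = {}")
  case False
  obtain a where "homotopic_with_canon (\<lambda>x. True) X X id (\<lambda>x. a)"
    using X(2) by (auto simp: contractible_def)
  then obtain h :: "real \<times> 'x \<Rightarrow> 'x"
    where h: "continuous_map (prod_topology (top_of_set {0..1}) (top_of_set X)) (top_of_set X) h"
      and h0: "\<And>x. h (0, x) = x" and h1: "\<And>x. h (1, x) = a"
    by (auto simp: homotopic_with_def)
  have h_cont: "continuous_on ({0..1} \<times> X) h" and h_in: "\<And>t x. t \<in> {0..1} \<Longrightarrow> x \<in> X \<Longrightarrow> h (t, x) \<in> X"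
    using h by (auto simp flip: subtopology_Times simp: Pi_iff)
  define G where "G p = proj n (f (h p))" for p
  have G_cont: "continuous_on ({0..1} \<times> X) G"
    unfolding G_def by (rule continuous_on_compose2[OF cont h_cont]) (use h_in in auto)
  have "uniformly_continuous_on ({0..1} \<times> X) G"
    by (intro compact_uniformly_continuous G_cont compact_Times X) auto
  then obtain d where d: "d > 0" "\<And>p q. p \<in> {0..1} \<times> X \<Longrightarrow> q \<in> {0..1} \<times> X \<Longrightarrow> dist p q < d \<Longrightarrow> dist (G p) (G q) < 1"
    unfolding uniformly_continuous_on_def by (metis zero_less_one)
  obtain N where N: "N \<noteq> 0" "inverse (real N) < d"
    using real_arch_inverse[of d] d(1) by auto
  \<comment> \<open>Time runs from 1 down to 0, since \<open>h\<close> is constant at 1, where a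
    constant frame exists, and the identity at 0, where the frame is wanted.\<close>
  define t where "t k = 1 - real k / real N" for k
  have t: "t k \<in> {0..1}" if "k \<le> N" for k
    using that N by (simp add: t_def)
  have "\<exists>v. (\<forall>i<n. continuous_on X (v i)) \<and>
    (\<forall>\<xi>\<in>X. orthonormal n (\<lambda>i. v i \<xi>) \<and> proj n (\<lambda>i. v i \<xi>) = G (t k, \<xi>))" if "k \<le> N" for k
    using that
  proof (induction k)
    case 0
    \<comment> \<open>The point \<open>a\<close> is known to lie in \<open>X\<close> only as a value
      of \<open>h\<close>, hence the separate case of empty \<open>X\<close>.\<close>
    have "a \<in> X" using h_in[of 1] h1 False by fastforce
    then show ?case
      using f by (intro exI[of _ "\<lambda>i _. f a i"]) (auto simp: t_def G_def h1)
  next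
    case (Suc k)
    then obtain v where v: "\<And>i. i < n \<Longrightarrow> continuous_on X (v i)"
      "\<And>\<xi>. \<xi> \<in> X \<Longrightarrow> orthonormal n (\<lambda>i. v i \<xi>)" "\<And>\<xi>. \<xi> \<in> X \<Longrightarrow> proj n (\<lambda>i. v i \<xi>) = G (t k, \<xi>)"
      by (metis Suc_leD)
    have tk: "t k \<in> {0..1}" "t (Suc k) \<in> {0..1}" using t Suc.prems by auto
    show ?case
      unfolding G_def
    proof (rule frame_transport_step[where e = v and f = "\<lambda>\<xi>. f (h (t (Suc k), \<xi>))"])
      show "continuous_on X (\<lambda>\<xi>. proj n (f (h (t (Suc k), \<xi>))))"
        unfolding G_def[symmetric]
        by (rule continuous_on_compose2[OF G_cont]) (use tk in \<open>auto intro!: continuous_intros\<close>)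
      fix \<xi> assume \<xi>: "\<xi> \<in> X"
      show "orthonormal n (f (h (t (Suc k), \<xi>)))" by (intro f h_in tk \<xi>)
      have "t k - t (Suc k) = inverse (real N)"
        using N by (simp add: t_def field_simps)
      then have "dist (t k, \<xi>) (t (Suc k), \<xi>) = inverse (real N)"
        by (simp add: dist_Pair_Pair dist_real_def)
      then have "dist (G (t k, \<xi>)) (G (t (Suc k), \<xi>)) < 1"
        using d(2)[of "(t k, \<xi>)" "(t (Suc k), \<xi>)"] tk \<xi> N by simp
      then show "norm (proj n (\<lambda>i. v i \<xi>) - proj n (f (h (t (Suc k), \<xi>)))) < 1"
        by (simp add: v(3)[OF \<xi>] dist_norm G_def)
    qed (use v in auto)
  qed
  from this[of N] show ?thesis
    using N by (simp add: t_def G_def h0)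
qed auto

end

section \<open>Compact operators and singular values\<close>

locale hilbert_pair = H1: hilbert_space s1 ip1 + H2: hilbert_space s2 ip2
  for s1 :: "'k::rc_field \<Rightarrow> 'a::banach \<Rightarrow> 'a" and ip1 :: "'a \<Rightarrow> 'a \<Rightarrow> 'k"
    and s2 :: "'k \<Rightarrow> 'b::banach \<Rightarrow> 'b" and ip2 :: "'b \<Rightarrow> 'b \<Rightarrow> 'k"
begin

lemma compact_ops_iff:
  "A \<in> compact_ops s1 s2 \<longleftrightarrow>
     (\<forall>c x. A (s1 c x) = s2 c (A x)) \<and> (\<forall>S. bounded S \<longrightarrow> compact (closure (blinfun_apply A ` S)))"
  unfolding compact_ops_def Vector_Spaces.linear_iff
  using H1.vector_space_axioms H2.vector_space_axioms by (auto simp: blinfun.add_right)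

lemma compact_ops_scale: "A \<in> compact_ops s1 s2 \<Longrightarrow> A (s1 c x) = s2 c (A x)"
  by (simp add: compact_ops_iff)

lemma compact_ops_zero: "0 \<in> compact_ops s1 s2"
proof -
  have "compact (closure ((\<lambda>x. 0 :: 'b) ` S))" for S :: "'a set"
    by (simp add: image_constant_conv)
  then show ?thesis by (simp add: compact_ops_iff)
qed

text \<open>The image of \<open>S\<close> lies in the set of differences of two compact sets, which
  is again compact.\<close>

lemma compact_ops_diff:
  assumes A: "A \<in> compact_ops s1 s2" and B: "B \<in> compact_ops s1 s2"
  shows "A - B \<in> compact_ops s1 s2"
proof -
  have "compact (closure (blinfun_apply (A - B) ` S))" if S: "bounded S" for S
  proof -
    let ?K = "{x - y |x y. x \<in> closure (blinfun_apply A ` S) \<and> y \<in> closure (blinfun_apply B ` S)}"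
    have K: "compact ?K"
      using A B S by (intro compact_differences) (auto simp: compact_ops_iff)
    have "blinfun_apply (A - B) ` S \<subseteq> ?K"
    proof
      fix z assume "z \<in> blinfun_apply (A - B) ` S"
      then obtain x where "x \<in> S" "z = A x - B x" by (auto simp: blinfun.diff_left)
      moreover have "A x \<in> closure (blinfun_apply A ` S)" "B x \<in> closure (blinfun_apply B ` S)"
        using \<open>x \<in> S\<close> by (auto intro: subsetD[OF closure_subset])
      ultimately show "z \<in> ?K" by blast
    qed
    then have "closure (blinfun_apply (A - B) ` S) \<subseteq> ?K"
      using K by (intro closure_minimal compact_imp_closed)
    then show ?thesis
      using compact_Int_closed[OF K closed_closure[of "blinfun_apply (A - B) ` S"]]
      by (simp add: Int_absorb1)
  qed
  then show ?thesis
    using A B by (simp add: compact_ops_iff blinfun.diff_left H2.scale_right_diff_distrib)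
qed

lemma compact_ops_compose:
  fixes P :: "'a \<Rightarrow>\<^sub>L 'a"
  assumes A: "A \<in> compact_ops s1 s2" and P: "\<And>c x. P (s1 c x) = s1 c (P x)"
  shows "A o\<^sub>L P \<in> compact_ops s1 s2"
proof -
  have "compact (closure (blinfun_apply (A o\<^sub>L P) ` S))" if "bounded S" for S
  proof -
    have "blinfun_apply (A o\<^sub>L P) ` S = blinfun_apply A ` (blinfun_apply P ` S)"
      by auto
    moreover have "bounded (blinfun_apply P ` S)"
      by (rule bounded_linear_image[OF that blinfun.bounded_linear_right])
    ultimately show ?thesis using A by (simp add: compact_ops_iff)
  qed
  then show ?thesis using A P by (simp add: compact_ops_iff)
qed

text \<open>Replaces the dimension and its infinite case by a spanning set of bounded size, the form
  in which rank is used from here on.\<close>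

lemma op_rank_le_iff:
  fixes L :: "'a \<Rightarrow>\<^sub>L 'b"
  shows "op_rank s2 L \<le> enat n \<longleftrightarrow>
    (\<exists>B. finite B \<and> card B \<le> n \<and> range (blinfun_apply L) \<subseteq> H2.span B)"
proof
  assume "op_rank s2 L \<le> enat n"
  then obtain F where F: "finite F" "range (blinfun_apply L) \<subseteq> H2.span F"
    and dim: "H2.dim (range (blinfun_apply L)) \<le> n"
    by (auto simp: op_rank_def split: if_splits)
  obtain B where B: "B \<subseteq> range (blinfun_apply L)" "H2.independent B"
      "range (blinfun_apply L) \<subseteq> H2.span B" "card B = H2.dim (range (blinfun_apply L))"
    by (rule H2.basis_exists)
  then have "finite B" using H2.independent_span_bound[of F B] F by blast
  then show "\<exists>B. finite B \<and> card B \<le> n \<and> range (blinfun_apply L) \<subseteq> H2.span B"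
    using B dim by auto
next
  assume "\<exists>B. finite B \<and> card B \<le> n \<and> range (blinfun_apply L) \<subseteq> H2.span B"
  then obtain B where B: "finite B" "card B \<le> n" "range (blinfun_apply L) \<subseteq> H2.span B" by blast
  then have "H2.dim (range (blinfun_apply L)) \<le> n"
    using H2.dim_le_card[of "range (blinfun_apply L)" B] by linarith
  then show "op_rank s2 L \<le> enat n" using B by (auto simp: op_rank_def)
qed

section \<open>Operators of bounded rank and singular values as approximation numbers\<close>

abbreviation rank_le :: "nat \<Rightarrow> ('a \<Rightarrow>\<^sub>L 'b) set" where
  "rank_le \<equiv> compact_ops_rank_le s1 s2"

abbreviation \<sigma> :: "nat \<Rightarrow> ('a \<Rightarrow>\<^sub>L 'b) \<Rightarrow> real" where
  "\<sigma> \<equiv> sing_val s1 s2"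

lemma rank_leI:
  assumes "L \<in> compact_ops s1 s2" "finite B" "card B \<le> n" "\<And>x. L x \<in> H2.span B"
  shows "L \<in> rank_le n"
  using assms unfolding compact_ops_rank_le_def by (auto simp: op_rank_le_iff)

lemma rank_leE:
  assumes "L \<in> rank_le n"
  obtains B where "finite B" "card B \<le> n" "\<forall>x. L x \<in> H2.span B"
proof -
  have "op_rank s2 L \<le> enat n" using assms by (simp add: compact_ops_rank_le_def)
  then show ?thesis using that unfolding op_rank_le_iff by blast
qed

lemma rank_le_compact: "L \<in> rank_le n \<Longrightarrow> L \<in> compact_ops s1 s2"
  by (simp add: compact_ops_rank_le_def)

lemma rank_le_mono: "L \<in> rank_le m \<Longrightarrow> m \<le> n \<Longrightarrow> L \<in> rank_le n"
  unfolding compact_ops_rank_le_def using order_trans[of "op_rank s2 L" "enat m" "enat n"] by simp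

lemma rank_le_zero: "0 \<in> rank_le n"
  by (rule rank_leI[of _ "{}"]) (auto simp: compact_ops_zero)

lemma rank_le_diff:
  assumes K: "K \<in> rank_le m" and L: "L \<in> rank_le n"
  shows "K - L \<in> rank_le (m + n)"
proof -
  obtain B where B: "finite B" "card B \<le> m" "\<forall>x. K x \<in> H2.span B"
    using K by (rule rank_leE)
  obtain C where C: "finite C" "card C \<le> n" "\<forall>x. L x \<in> H2.span C"
    using L by (rule rank_leE)
  show ?thesis
  proof (rule rank_leI)
    show "card (B \<union> C) \<le> m + n" using card_Un_le[of B C] B C by linarith
    fix x
    show "(K - L) x \<in> H2.span (B \<union> C)"
      unfolding blinfun.diff_left
    proof (rule H2.span_diff)
      show "K x \<in> H2.span (B \<union> C)" using H2.span_mono[of B "B \<union> C"] B(3) by blast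
      show "L x \<in> H2.span (B \<union> C)" using H2.span_mono[of C "B \<union> C"] C(3) by blast
    qed
      show "K - L \<in> compact_ops s1 s2" by (intro compact_ops_diff) (rule rank_le_compact, fact)+
  qed (use B C in auto)
qed

lemma rank_le_add:
  assumes "K \<in> rank_le m" "L \<in> rank_le n"
  shows "K + L \<in> rank_le (m + n)"
  using rank_le_diff[OF assms(1) rank_le_diff[OF rank_le_zero[of 0] assms(2)]] by simp

text \<open>Singular values are mostly handled at \<open>Suc n\<close>, whose competitors have rank
  at most \<open>n\<close>, so that the subtraction in \<open>sing_val_def\<close>
  disappears.\<close>

lemma sing_val_le: "L \<in> rank_le n \<Longrightarrow> \<sigma> (Suc n) A \<le> norm (A - L)"
  unfolding sing_val_def by (intro cINF_lower bdd_belowI2[of _ 0]) auto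

lemma sing_val_greatest: "(\<And>L. L \<in> rank_le n \<Longrightarrow> c \<le> norm (A - L)) \<Longrightarrow> c \<le> \<sigma> (Suc n) A"
  unfolding sing_val_def using rank_le_zero by (intro cINF_greatest) auto

lemma sing_val_nonneg: "0 \<le> \<sigma> (Suc n) A"
  by (rule sing_val_greatest) simp

lemma sing_val_antimono: "m \<le> n \<Longrightarrow> \<sigma> (Suc n) A \<le> \<sigma> (Suc m) A"
  by (rule sing_val_greatest, rule sing_val_le, rule rank_le_mono)

lemma sing_val_le_norm: "\<sigma> (Suc n) A \<le> norm A"
  using sing_val_le[OF rank_le_zero] by simp

lemma sing_val_perturb: "\<sigma> (Suc n) A \<le> \<sigma> (Suc n) B + norm (A - B)"
proof -
  have "\<sigma> (Suc n) A - norm (A - B) \<le> \<sigma> (Suc n) B"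
  proof (rule sing_val_greatest)
    fix L assume "L \<in> rank_le n"
    then have "\<sigma> (Suc n) A \<le> norm (A - L)" by (rule sing_val_le)
    also have "\<dots> \<le> norm (B - L) + norm (A - B)"
      using norm_triangle_ineq[of "B - L" "A - B"] by simp
    finally show "\<sigma> (Suc n) A - norm (A - B) \<le> norm (B - L)" by simp
  qed
  then show ?thesis by simp
qed

lemma sing_val_1: "\<sigma> (Suc 0) A = norm A"
proof (rule antisym[OF sing_val_le_norm sing_val_greatest])
  fix L assume "L \<in> rank_le 0"
  then obtain B where "finite B" "card B \<le> 0" "\<forall>x. L x \<in> H2.span B"
    by (rule rank_leE)
  then have "L = 0" by (intro blinfun_eqI) auto
  then show "norm A \<le> norm (A - L)" by simp
qed

text \<open>If \<open>K\<close> competes for \<open>A - L\<close>, then \<open>K + L\<close>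
  competes for \<open>A\<close>. Removing rank \<open>m\<close> thus shifts the singular values by
  at most \<open>m\<close> places, which is the lower bound behind both optimality claims.\<close>

lemma sing_val_diff_rank_le:
  assumes "L \<in> rank_le m"
  shows "\<sigma> (Suc (i + m)) A \<le> \<sigma> (Suc i) (A - L)"
proof (rule sing_val_greatest)
  fix K assume "K \<in> rank_le i"
  from sing_val_le[OF rank_le_add[OF this assms], of A]
  show "\<sigma> (Suc (i + m)) A \<le> norm (A - L - K)" by (simp add: algebra_simps)
qed

text \<open>By the parallelogram law a maximising sequence is Cauchy as soon as its image converges,
  so no weak compactness is needed.\<close>

lemma compact_norm_attained:
  assumes T: "T \<in> compact_ops s1 s2" "T \<noteq> 0"
  obtains u where "norm u = 1" "norm (T u) = norm T"
proof -
  define N where "N = norm T"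
  have N: "N > 0" using T by (simp add: N_def)
  have "\<exists>x. norm x = 1 \<and> N - inverse (real (Suc k)) < norm (T x)" for k
  proof -
    \<comment> \<open>The maximum with 0 makes \<open>b\<close> a legitimate bound for
      \<open>norm_blinfun_bound\<close>.\<close>
    define b where "b = max 0 (N - inverse (real (Suc k)))"
    have "b < N" using N by (auto simp: b_def)
    then obtain x where x: "norm (T x) > b * norm x"
      using norm_blinfun_bound[of b T] unfolding N_def b_def by (metis max.cobounded1 not_le)
    then have "x \<noteq> 0" by auto
    define y where "y = (1 / norm x) *\<^sub>R x"
    have "norm y = 1" using \<open>x \<noteq> 0\<close> by (simp add: y_def)
    moreover have "norm (T y) > b"
      using x \<open>x \<noteq> 0\<close> by (simp add: y_def blinfun.scaleR_right field_simps)
    ultimately show ?thesis unfolding b_def by (intro exI[of _ y]) auto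
  qed
  then obtain x where x: "\<And>k. norm (x k) = 1" "\<And>k. N - inverse (real (Suc k)) < norm (T (x k))"
    by metis
  have "compact (closure (blinfun_apply T ` cball 0 1))"
    using T(1) by (simp add: compact_ops_iff)
  moreover have "T (x k) \<in> closure (blinfun_apply T ` cball 0 1)" for k
    using closure_subset x(1)[of k] by fastforce
  ultimately obtain l r where r: "strict_mono (r :: nat \<Rightarrow> nat)" and l: "((\<lambda>k. T (x k)) \<circ> r) \<longlonglongrightarrow> l"
    unfolding compact_def by (metis (no_types, lifting))
  define z where "z k = x (r k)" for k
  have z: "norm (z k) = 1" for k by (simp add: z_def x)
  have Tz: "(\<lambda>k. T (z k)) \<longlonglongrightarrow> l" using l by (simp add: z_def comp_def)
  have "(\<lambda>k. norm (T (x k))) \<longlonglongrightarrow> N"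
  proof (rule tendsto_sandwich[where f = "\<lambda>k. N - inverse (real (Suc k))" and h = "\<lambda>_. N"])
    show "(\<lambda>k. N - inverse (real (Suc k))) \<longlonglongrightarrow> N"
      using tendsto_diff[OF tendsto_const[of N] LIMSEQ_inverse_real_of_nat] by simp
    show "\<forall>\<^sub>F k in sequentially. norm (T (x k)) \<le> N"
      using norm_blinfun[of T] by (intro always_eventually allI) (metis N_def mult.right_neutral x(1))
  qed (use x(2) in \<open>auto intro!: always_eventually less_imp_le\<close>)
  then have "(\<lambda>k. norm (T (z k))) \<longlonglongrightarrow> N"
    using LIMSEQ_subseq_LIMSEQ[OF _ r] by (fastforce simp: z_def comp_def)
  then have l_norm: "norm l = N"
    using LIMSEQ_unique tendsto_norm[OF Tz] by blast
  have "Cauchy z"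
  proof (rule CauchyI)
    fix e :: real assume e: "0 < e"
    \<comment> \<open>Chosen so that \<open>2 * d\<close> is \<open>N\<close> times
      \<open>e^2 / 8\<close>. Then \<open>2 - ?q\<close> is at most \<open>e^2 / 8\<close>, and the
      parallelogram law bounds the squared distance by \<open>e^2 / 2\<close>.\<close>
    define d where "d = N * e\<^sup>2 / 16"
    have d: "0 < d" using N e by (simp add: d_def)
    obtain k0 where k0: "\<And>k. k \<ge> k0 \<Longrightarrow> norm (T (z k) - l) < d"
      using LIMSEQ_D[OF Tz d] by blast
    have "norm (z i - z j) < e" if ij: "i \<ge> k0" "j \<ge> k0" for i j
    proof (rule power2_less_imp_less)
      let ?q = "norm (z i + z j)"
      have "norm (2 *\<^sub>R l) \<le> norm (T (z i) + T (z j)) + norm (T (z i) - l) + norm (T (z j) - l)"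
      proof -
        have "2 *\<^sub>R l = T (z i) + T (z j) - (T (z i) - l) - (T (z j) - l)"
          by (simp add: scaleR_2)
        then show ?thesis
          by (smt (verit) norm_triangle_ineq4)
      qed
      then have "2 * N \<le> norm (T (z i + z j)) + 2 * d"
        using k0[OF ij(1)] k0[OF ij(2)] l_norm by (simp add: blinfun.add_right)
      also have "\<dots> \<le> N * ?q + 2 * d"
        using norm_blinfun[of T "z i + z j"] by (simp add: N_def)
      finally have "N * (2 - ?q) \<le> N * (e\<^sup>2 / 8)" by (simp add: d_def algebra_simps)
      then have q: "2 - ?q \<le> e\<^sup>2 / 8" using N by simp
      have q2: "?q \<le> 2" using norm_triangle_ineq[of "z i" "z j"] by (simp add: z)
      have "(norm (z i - z j))\<^sup>2 = (2 - ?q) * (2 + ?q)"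
        using H1.parallelogram[of "z i" "z j"] by (simp add: z power2_eq_square algebra_simps)
      also have "\<dots> \<le> (e\<^sup>2 / 8) * 4"
        by (rule mult_mono[OF q]) (use q2 in auto)
      also have "\<dots> < e\<^sup>2" using e by simp
      finally show "(norm (z i - z j))\<^sup>2 < e\<^sup>2" .
    qed (use e in simp)
    then show "\<exists>M. \<forall>m\<ge>M. \<forall>n\<ge>M. norm (z m - z n) < e" by blast
  qed
  then obtain u where u: "z \<longlonglongrightarrow> u" using Cauchy_convergent convergent_def by blast
  have "norm u = 1"
    using LIMSEQ_unique[OF tendsto_norm[OF u]] by (simp add: z)
  moreover have "T u = l"
    using LIMSEQ_unique[OF blinfun.tendsto[OF tendsto_const u] Tz] .
  ultimately show ?thesis using that l_norm N_def by blast
qed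

text \<open>The form |T|^2 |y|^2 - |T y|^2 is nonnegative and vanishes at \<open>u\<close>, so its
  first-order term at \<open>u\<close> must vanish in every direction \<open>x\<close>. This is the
  weak form of the eigenvector equation for the adjoint of \<open>T\<close> composed with
  \<open>T\<close>.\<close>

lemma norm_maximizer_adjoint_eq:
  fixes T :: "'a \<Rightarrow>\<^sub>L 'b"
  assumes lin: "\<And>c x. T (s1 c x) = s2 c (T x)" and u: "norm u = 1" "norm (blinfun_apply T u) = norm T"
  shows "ip2 (T x) (T u) = of_real ((norm T)\<^sup>2) * ip1 x u"
proof (rule ccontr)
  \<comment> \<open>\<open>b\<close> is the defect of the claim and \<open>K\<close> the value of
    the form at \<open>x\<close>. The phase of \<open>c\<close> makes the linear term real, namely
    -2t|b|^2, against the quadratic term t^2|b|^2 K; \<open>t = 1 / (K + 1)\<close> gives tK < 1, so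
    the linear term wins.\<close>
  define b where "b = of_real ((norm T)\<^sup>2) * ip1 x u - ip2 (T x) (T u)"
  define K where "K = (norm T)\<^sup>2 * (norm x)\<^sup>2 - (norm (T x))\<^sup>2"
  define t where "t = 1 / (K + 1)"
  define c where "c = of_real (- t) * conjugate b"
  define y where "y = s1 c x + u"
  assume "ip2 (T x) (T u) \<noteq> of_real ((norm T)\<^sup>2) * ip1 x u"
  then have b: "norm b > 0" by (auto simp: b_def)
  have bound: "(norm (T z))\<^sup>2 \<le> (norm T)\<^sup>2 * (norm z)\<^sup>2" for z
    by (metis norm_blinfun norm_ge_zero power_mono power_mult_distrib)
  have K: "0 \<le> K" using bound[of x] by (simp add: K_def)
  have cb: "c * b = of_real (- t * (norm b)\<^sup>2)"
    using mult_conjugate[of b] by (simp add: c_def mult.assoc mult.commute[of _ b])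
  have nc: "(norm c)\<^sup>2 = t\<^sup>2 * (norm b)\<^sup>2"
    by (simp add: c_def norm_mult power_mult_distrib)
  have y2: "of_real ((norm y)\<^sup>2) = of_real ((norm c)\<^sup>2 * (norm x)\<^sup>2 + 1) + (c * ip1 x u + conjugate (c * ip1 x u))"
    unfolding y_def H1.norm_add_square
    by (simp add: H1.norm_scale u power_mult_distrib H1.ip_scale_left)
  have Ty2: "of_real ((norm (T y))\<^sup>2) = of_real ((norm c)\<^sup>2 * (norm (T x))\<^sup>2 + (norm T)\<^sup>2)
      + (c * ip2 (T x) (T u) + conjugate (c * ip2 (T x) (T u)))"
    unfolding y_def blinfun.add_right lin H2.norm_add_square
    by (simp add: H2.norm_scale u power_mult_distrib H2.ip_scale_left)
  have "of_real ((norm T)\<^sup>2 * (norm y)\<^sup>2 - (norm (T y))\<^sup>2)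
      = of_real ((norm c)\<^sup>2 * K) + (c * b + conjugate (c * b))"
    unfolding of_real_diff of_real_mult[of "(norm T)\<^sup>2" "(norm y)\<^sup>2"] y2 Ty2 b_def K_def
    by (simp add: algebra_simps conjugate_dist_mul conjugate_dist_diff del: of_real_power)
  also have "\<dots> = of_real ((norm c)\<^sup>2 * K - 2 * t * (norm b)\<^sup>2)"
    unfolding cb conjugate_of_real by (simp flip: of_real_add del: of_real_power)
  finally have "(norm T)\<^sup>2 * (norm y)\<^sup>2 - (norm (T y))\<^sup>2 = (norm c)\<^sup>2 * K - 2 * t * (norm b)\<^sup>2"
    by (simp only: of_real_eq_iff)
  then have "0 \<le> (norm c)\<^sup>2 * K - 2 * t * (norm b)\<^sup>2" using bound[of y] by linarith
  also have "\<dots> = t * (norm b)\<^sup>2 * (t * K - 2)"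
    unfolding nc by (simp add: power2_eq_square algebra_simps)
  also have "\<dots> < 0"
  proof (rule mult_pos_neg)
    show "0 < t * (norm b)\<^sup>2" using K b by (simp add: t_def)
    show "t * K - 2 < 0" using K by (simp add: t_def field_simps)
  qed
  finally show False by simp
qed

end

section \<open>Singular systems and truncations\<close>

context hilbert_pair
begin

text \<open>The second clause is the weak eigenvector equation, the third says that
  \<open>u i\<close> maximises on the orthogonal complement of its predecessors. Requiring nonzero
  images allows left vectors to be normalised and stops a system once \<open>A\<close> is
  exhausted.\<close>

definition singular_system :: "('a \<Rightarrow>\<^sub>L 'b) \<Rightarrow> nat \<Rightarrow> (nat \<Rightarrow> 'a) \<Rightarrow> bool" where
  "singular_system A m u \<longleftrightarrow> H1.orthonormal m u \<and>
     (\<forall>i<m. A (u i) \<noteq> 0 \<and>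
        (\<forall>x. ip2 (A x) (A (u i)) = of_real ((norm (A (u i)))\<^sup>2) * ip1 x (u i)) \<and>
        (\<forall>x. (\<forall>j<i. ip1 x (u j) = 0) \<longrightarrow> norm (A x) \<le> norm (A (u i)) * norm x))"

text \<open>For a singular system this is the truncated singular value decomposition of
  \<open>A\<close>; composing with \<open>proj\<close> avoids naming the left vectors.\<close>

definition truncation :: "('a \<Rightarrow>\<^sub>L 'b) \<Rightarrow> nat \<Rightarrow> (nat \<Rightarrow> 'a) \<Rightarrow> 'a \<Rightarrow>\<^sub>L 'b" where
  "truncation A m u = A o\<^sub>L H1.proj m u"

lemma truncation_apply: "truncation A m u x = A (H1.proj m u x)"
  by (simp add: truncation_def)

lemma singular_system_orthonormal: "singular_system A m u \<Longrightarrow> H1.orthonormal m u"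
  by (simp add: singular_system_def)

lemma singular_system_eq:
  "singular_system A m u \<Longrightarrow> i < m \<Longrightarrow> ip2 (A x) (A (u i)) = of_real ((norm (A (u i)))\<^sup>2) * ip1 x (u i)"
  by (simp add: singular_system_def)

lemma singular_system_max:
  "singular_system A m u \<Longrightarrow> i < m \<Longrightarrow> (\<And>j. j < i \<Longrightarrow> ip1 x (u j) = 0) \<Longrightarrow>
     norm (A x) \<le> norm (A (u i)) * norm x"
  by (simp add: singular_system_def)

lemma singular_system_nonzero: "singular_system A m u \<Longrightarrow> i < m \<Longrightarrow> A (u i) \<noteq> 0"
  by (simp add: singular_system_def)

lemma singular_system_restrict: "singular_system A m u \<Longrightarrow> k \<le> m \<Longrightarrow> singular_system A k u"
  unfolding singular_system_def using H1.orthonormal_mono[of m u k] by auto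

lemma singular_system_orthogonal:
  "singular_system A m u \<Longrightarrow> i < m \<Longrightarrow> j < m \<Longrightarrow> i \<noteq> j \<Longrightarrow> ip2 (A (u i)) (A (u j)) = 0"
  by (simp add: singular_system_eq H1.orthonormalD[OF singular_system_orthonormal])

lemma singular_system_antimono:
  assumes "singular_system A m u" "j \<le> i" "i < m"
  shows "norm (A (u i)) \<le> norm (A (u j))"
proof -
  have "norm (A (u i)) \<le> norm (A (u j)) * norm (u i)"
    by (rule singular_system_max)
       (use assms H1.orthonormalD[OF singular_system_orthonormal] in auto)
  then show ?thesis
    using assms by (simp add: H1.orthonormal_norm[OF singular_system_orthonormal])
qed

text \<open>The images \<open>A (u i)\<close> are pairwise orthogonal, so the squared norm of the
  image is diagonal in the coefficients.\<close>

lemma norm_singular_combination: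
  assumes A: "A \<in> compact_ops s1 s2" and u: "singular_system A m u" and k: "k \<le> m"
  shows "(norm (A (\<Sum>i<k. s1 (c i) (u i))))\<^sup>2 = (\<Sum>i<k. (norm (c i))\<^sup>2 * (norm (A (u i)))\<^sup>2)"
proof -
  have "(norm (A (\<Sum>i<k. s1 (c i) (u i))))\<^sup>2 = (norm (\<Sum>i<k. s2 (c i) (A (u i))))\<^sup>2"
    by (simp add: blinfun.sum_right compact_ops_scale[OF A])
  also have "\<dots> = (\<Sum>i<k. (norm (s2 (c i) (A (u i))))\<^sup>2)"
    by (rule H2.norm_orthogonal_sum)
       (use u k in \<open>auto simp: H2.ip_scale_left H2.ip_scale_right singular_system_orthogonal\<close>)
  finally show ?thesis by (simp add: H2.norm_scale power_mult_distrib)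
qed

lemma truncation_rank_le_diff:
  assumes A: "A \<in> compact_ops s1 s2" and "m \<le> k"
  shows "truncation A k u - truncation A m u \<in> rank_le (k - m)"
proof (rule rank_leI)
  have "A o\<^sub>L H1.proj l u \<in> compact_ops s1 s2" for l
    using A by (rule compact_ops_compose) (rule H1.proj_scale)
  then show "truncation A k u - truncation A m u \<in> compact_ops s1 s2"
    unfolding truncation_def by (intro compact_ops_diff)
  show "card ((\<lambda>i. A (u i)) ` {m..<k}) \<le> k - m"
    using card_image_le[of "{m..<k}" "\<lambda>i. A (u i)"] by simp
  fix x
  have "(truncation A k u - truncation A m u) x = (\<Sum>i\<in>{m..<k}. s2 (ip1 x (u i)) (A (u i)))"
    using assms(2)
    by (simp add: blinfun.diff_left truncation_apply H1.proj_apply blinfun.sum_right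
          compact_ops_scale[OF A] lessThan_atLeast0 sum_diff_nat_ivl)
  also have "\<dots> \<in> H2.span ((\<lambda>i. A (u i)) ` {m..<k})"
    by (intro H2.span_sum H2.span_scale H2.span_base) auto
  finally show "(truncation A k u - truncation A m u) x \<in> H2.span ((\<lambda>i. A (u i)) ` {m..<k})" .
qed simp

lemma truncation_0: "truncation A 0 u = 0"
  by (intro blinfun_eqI) (simp add: truncation_apply H1.proj_apply)

lemma truncation_rank_le: "A \<in> compact_ops s1 s2 \<Longrightarrow> truncation A m u \<in> rank_le m"
  using truncation_rank_le_diff[of A 0 m u] by (simp add: truncation_0)

lemma truncation_residual_le:
  fixes A :: "'a \<Rightarrow>\<^sub>L 'b"
  assumes u: "H1.orthonormal m u" and "\<And>x. (\<And>j. j < m \<Longrightarrow> ip1 x (u j) = 0) \<Longrightarrow> norm (A x) \<le> c * norm x"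
    "0 \<le> c"
  shows "norm (A - truncation A m u) \<le> c"
proof (rule norm_blinfun_bound)
  fix x
  have "norm ((A - truncation A m u) x) = norm (A (x - H1.proj m u x))"
    by (simp add: blinfun.diff_left blinfun.diff_right truncation_apply)
  also have "\<dots> \<le> c * norm (x - H1.proj m u x)"
    using H1.ip_residual[OF u] by (rule assms(2))
  also have "\<dots> \<le> c * norm x"
    by (intro mult_left_mono H1.norm_residual_le u assms)
  finally show "norm ((A - truncation A m u) x) \<le> c * norm x" .
qed fact

text \<open>The new vector is a norm maximiser \<open>w\<close> of the residual \<open>T\<close>.
  Since \<open>T\<close> kills each \<open>u j\<close>, the maximiser equation makes
  \<open>w\<close> orthogonal to them, whence \<open>T w = A w\<close>; the equation passes from
  \<open>T\<close> to \<open>A\<close> because \<open>A w\<close> is orthogonal to every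
  \<open>A (u i)\<close>.\<close>

lemma singular_system_extend:
  assumes A: "A \<in> compact_ops s1 s2" and u: "singular_system A m u" and ne: "A \<noteq> truncation A m u"
  obtains w where "singular_system A (Suc m) (u(m := w))"
proof -
  define T where "T = A - truncation A m u"
  have T: "T \<in> compact_ops s1 s2"
    unfolding T_def using A rank_le_compact[OF truncation_rank_le[OF A]] by (rule compact_ops_diff)
  have "T \<noteq> 0" using ne by (simp add: T_def)
  then obtain w where w: "norm w = 1" "norm (T w) = norm T"
    using compact_norm_attained[OF T] by blast
  have N: "norm T > 0" using \<open>T \<noteq> 0\<close> by simp
  have Tx: "T x = A x - A (H1.proj m u x)" for x
    by (simp add: T_def blinfun.diff_left truncation_apply)
  note on = singular_system_orthonormal[OF u]
  note eq = norm_maximizer_adjoint_eq[OF compact_ops_scale[OF T] w]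
  have orth: "ip1 (u j) w = 0" if "j < m" for j
  proof -
    have "T (u j) = 0" by (simp add: Tx H1.proj_self[OF on that])
    then show ?thesis using eq[of "u j"] N by simp
  qed
  then have orth': "ip1 w (u j) = 0" if "j < m" for j
    using that by (simp add: H1.ip_zero_swap)
  have "H1.proj m u w = 0"
    by (simp add: H1.proj_apply orth')
  then have Tw: "T w = A w" by (simp add: Tx)
  have Aw: "norm (A w) = norm T" using Tw w by simp
  have A_eq: "ip2 (A x) (A w) = of_real ((norm (A w))\<^sup>2) * ip1 x w" for x
  proof -
    have "ip2 (A (u i)) (A w) = 0" if "i < m" for i
      using singular_system_eq[OF u that, of w] orth'[OF that] by (simp add: H2.ip_zero_swap)
    then have "ip2 (A (H1.proj m u x)) (A w) = 0"
      by (auto simp: H1.proj_apply blinfun.sum_right compact_ops_scale[OF A] H2.ip_sum_left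
            H2.ip_scale_left intro!: sum.neutral)
    then have "ip2 (A x) (A w) = ip2 (T x) (T w)"
      by (simp add: Tx[of x] Tw H2.ip_diff_left)
    then show ?thesis using eq[of x] Aw by simp
  qed
  have A_max: "norm (A x) \<le> norm (A w) * norm x" if "\<And>j. j < m \<Longrightarrow> ip1 x (u j) = 0" for x
  proof -
    have "A x = T x" using that by (simp add: Tx H1.proj_apply)
    then show ?thesis using norm_blinfun[of T x] Aw by simp
  qed
  have ww: "ip1 w w = 1" by (simp add: H1.ip_self w)
  have on': "H1.orthonormal (Suc m) (u(m := w))"
    using on orth orth' ww unfolding H1.orthonormal_def by (auto simp: less_Suc_eq)
  have "singular_system A (Suc m) (u(m := w))"
    unfolding singular_system_def
  proof (intro conjI on' allI impI)
    fix i x assume i: "i < Suc m"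
    show "A ((u(m := w)) i) \<noteq> 0"
      using i singular_system_nonzero[OF u, of i] Aw N by (auto simp: less_Suc_eq)
    show "ip2 (A x) (A ((u(m := w)) i)) = of_real ((norm (A ((u(m := w)) i)))\<^sup>2) * ip1 x ((u(m := w)) i)"
      using i singular_system_eq[OF u, of i] A_eq by (auto simp: less_Suc_eq)
    assume "\<forall>j<i. ip1 x ((u(m := w)) j) = 0"
    then show "norm (A x) \<le> norm (A ((u(m := w)) i)) * norm x"
      using i singular_system_max[OF u, of i x] A_max[of x] by (auto simp: less_Suc_eq)
  qed
  then show ?thesis by (rule that)
qed

text \<open>A competitor \<open>L\<close> of rank at most \<open>i\<close> kills a nonzero
  combination \<open>x\<close> of the \<open>Suc i\<close> vectors \<open>u 0\<close>, ...,
  \<open>u i\<close>. On their span \<open>A\<close> stretches by at least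
  \<open>norm (A (u i))\<close>, and there \<open>A x = (A - L) x\<close>.\<close>

lemma norm_le_sing_val:
  assumes A: "A \<in> compact_ops s1 s2" and u: "singular_system A m u" and i: "i < m"
  shows "norm (A (u i)) \<le> \<sigma> (Suc i) A"
proof (rule sing_val_greatest)
  fix L assume "L \<in> rank_le i"
  then have L: "L \<in> compact_ops s1 s2" by (rule rank_le_compact)
  obtain B where B: "finite B" "card B \<le> i" "\<forall>x. L x \<in> H2.span B"
    using \<open>L \<in> rank_le i\<close> by (rule rank_leE)
  obtain c where c: "\<exists>k<Suc i. c k \<noteq> 0" "(\<Sum>k<Suc i. s2 (c k) (L (u k))) = 0"
    by (rule H2.exists_dependency[of B "Suc i" "\<lambda>k. L (u k)"]) (use B in auto)
  define x where "x = (\<Sum>k<Suc i. s1 (c k) (u k))"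
  have on: "H1.orthonormal (Suc i) u"
    using singular_system_orthonormal[OF u] i by (auto intro: H1.orthonormal_mono)
  have x2: "(norm x)\<^sup>2 = (\<Sum>k<Suc i. (norm (c k))\<^sup>2)"
    unfolding x_def by (rule H1.norm_orthonormal_sum[OF on])
  have "x \<noteq> 0"
  proof
    assume "x = 0"
    then have "(\<Sum>k<Suc i. (norm (c k))\<^sup>2) = 0" using x2 by simp
    then show False using c(1) by (subst (asm) sum_nonneg_eq_0_iff) auto
  qed
  have "L x = 0"
    using c(2) by (simp add: x_def blinfun.sum_right blinfun.add_right compact_ops_scale[OF L])
  have "(norm (A (u i)) * norm x)\<^sup>2 = (\<Sum>k<Suc i. (norm (c k))\<^sup>2 * (norm (A (u i)))\<^sup>2)"
    by (simp only: power_mult_distrib x2 sum_distrib_left mult.commute)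
  also have "\<dots> \<le> (\<Sum>k<Suc i. (norm (c k))\<^sup>2 * (norm (A (u k)))\<^sup>2)"
    by (intro sum_mono mult_left_mono power_mono singular_system_antimono[OF u]) (use i in auto)
  also have "\<dots> = (norm (A x))\<^sup>2"
    unfolding x_def by (rule norm_singular_combination[OF A u, symmetric]) (use i in simp)
  finally have "norm (A (u i)) * norm x \<le> norm (A x)"
    by (rule power2_le_imp_le) simp
  also have "A x = (A - L) x" by (simp add: blinfun.diff_left \<open>L x = 0\<close>)
  also have "norm \<dots> \<le> norm (A - L) * norm x" by (rule norm_blinfun)
  finally show "norm (A (u i)) \<le> norm (A - L)" using \<open>x \<noteq> 0\<close> by simp
qed

text \<open>If the residual is nonzero, the system can be extended by some \<open>w\<close>; the
  residual is bounded by \<open>norm (A w)\<close>, and that by the singular value.\<close>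

lemma norm_singular_residual:
  assumes A: "A \<in> compact_ops s1 s2" and u: "singular_system A m u"
  shows "norm (A - truncation A m u) = \<sigma> (Suc m) A"
proof (rule antisym)
  show "\<sigma> (Suc m) A \<le> norm (A - truncation A m u)"
    by (rule sing_val_le[OF truncation_rank_le[OF A]])
  show "norm (A - truncation A m u) \<le> \<sigma> (Suc m) A"
  proof (cases "A = truncation A m u")
    case True
    then show ?thesis using sing_val_nonneg by simp
  next
    case False
    then obtain w where w: "singular_system A (Suc m) (u(m := w))"
      using singular_system_extend[OF A u] by blast
    have "norm (A - truncation A m u) \<le> norm (A w)"
      using singular_system_max[OF w, of m] singular_system_orthonormal[OF u]
      by (intro truncation_residual_le) auto
    also have "\<dots> \<le> \<sigma> (Suc m) A" using norm_le_sing_val[OF A w, of m] by simp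
    finally show ?thesis .
  qed
qed

lemma norm_singular_vector:
  assumes A: "A \<in> compact_ops s1 s2" and u: "singular_system A m u" and i: "i < m"
  shows "norm (A (u i)) = \<sigma> (Suc i) A"
proof (rule antisym[OF norm_le_sing_val[OF assms]])
  have ui: "singular_system A i u" by (rule singular_system_restrict[OF u]) (use i in simp)
  then have "norm (A - truncation A i u) \<le> norm (A (u i))"
    using singular_system_max[OF u i] singular_system_orthonormal[OF ui]
    by (intro truncation_residual_le) auto
  then show "\<sigma> (Suc i) A \<le> norm (A (u i))"
    by (simp add: norm_singular_residual[OF A ui])
qed

lemma truncation_cong: "(\<And>i. i < m \<Longrightarrow> u i = v i) \<Longrightarrow> truncation A m u = truncation A m v"
  by (intro blinfun_eqI) (simp add: truncation_apply H1.proj_apply)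

text \<open>For \<open>A\<close> of small rank the extension stops early, but then \<open>A\<close>
  equals its truncation, which serves as well. The first \<open>n\<close> vectors are kept so that
  the truncation at \<open>n\<close> does not change.\<close>

lemma singular_system_continue:
  assumes A: "A \<in> compact_ops s1 s2" and u: "singular_system A n u" and "n \<le> m"
  obtains k v where "n \<le> k" "k \<le> m" "\<And>j. j < n \<Longrightarrow> v j = u j" "singular_system A k v"
    "k = m \<or> A = truncation A k v"
proof -
  have "\<exists>k v. n \<le> k \<and> k \<le> m \<and> (\<forall>j<n. v j = u j) \<and> singular_system A k v \<and> (k = m \<or> A = truncation A k v)"
    using \<open>n \<le> m\<close>
  proof (induction m rule: dec_induct)
    case base
    then show ?case using u by blast
  next
    case (step m)
    then obtain k v where kv: "n \<le> k" "k \<le> m" "\<forall>j<n. v j = u j" "singular_system A k v"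
      "k = m \<or> A = truncation A k v" by blast
    show ?case
    proof (cases "A = truncation A k v")
      case True
      then show ?thesis using kv by (intro exI[of _ k] exI[of _ v]) auto
    next
      case False
      then obtain w where "singular_system A (Suc k) (v(k := w))"
        using singular_system_extend[OF A kv(4)] by blast
      moreover have "\<forall>j<n. (v(k := w)) j = u j" "n \<le> Suc k" "Suc k = Suc m"
        using kv False by auto
      ultimately show ?thesis by blast
    qed
  qed
  then show ?thesis using that by blast
qed

text \<open>Stopping at some \<open>k < n\<close> would make the residual zero, hence
  \<open>\<sigma> (Suc k) A = 0\<close>, against monotonicity and
  \<open>\<sigma> n A > 0\<close>.\<close>

lemma singular_system_exists:
  assumes A: "A \<in> compact_ops s1 s2" and n: "n \<ge> 1" and pos: "\<sigma> n A > 0"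
  obtains u where "singular_system A n u"
proof -
  have 0: "singular_system A 0 (\<lambda>_. 0)"
    by (simp add: singular_system_def H1.orthonormal_def)
  obtain k v where kv: "k \<le> n" "singular_system A k v" "k = n \<or> A = truncation A k v"
    by (rule singular_system_continue[OF A 0 le0])
  have "k = n"
  proof (rule ccontr)
    assume "k \<noteq> n"
    then have "norm (A - truncation A k v) = 0" using kv by simp
    then have "\<sigma> (Suc k) A = 0" by (simp only: norm_singular_residual[OF A kv(2)])
    moreover have "k \<le> n - 1" using \<open>k \<noteq> n\<close> kv(1) by simp
    ultimately show False
      using sing_val_antimono[of k "n - 1" A] n pos by simp
  qed
  then show ?thesis using kv that by blast
qed

text \<open>For the upper bound the competitor is the part between the truncations at
  \<open>n\<close> and at \<open>i + n\<close>, of rank at most \<open>i\<close>; subtracting it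
  leaves the residual at \<open>i + n\<close>.\<close>

lemma sing_val_residual:
  assumes A: "A \<in> compact_ops s1 s2" and u: "singular_system A n u"
  shows "\<sigma> (Suc i) (A - truncation A n u) = \<sigma> (Suc (i + n)) A"
proof (rule antisym)
  obtain k v where kv: "n \<le> k" "k \<le> i + n" "\<And>j. j < n \<Longrightarrow> v j = u j" "singular_system A k v"
    "k = i + n \<or> A = truncation A k v"
    using singular_system_continue[OF A u, of "i + n"] by auto
  have tr: "truncation A n u = truncation A n v" using kv by (intro truncation_cong) auto
  have "truncation A k v - truncation A n v \<in> rank_le i"
    by (rule rank_le_mono[OF truncation_rank_le_diff[OF A]]) (use kv in auto)
  from sing_val_le[OF this, of "A - truncation A n u"]
  have "\<sigma> (Suc i) (A - truncation A n u) \<le> norm (A - truncation A k v)"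
    by (simp add: tr)
  also have "\<dots> \<le> \<sigma> (Suc (i + n)) A"
    using kv(5) norm_singular_residual[OF A kv(4)] sing_val_nonneg[of "i + n" A] by auto
  finally show "\<sigma> (Suc i) (A - truncation A n u) \<le> \<sigma> (Suc (i + n)) A" .
  show "\<sigma> (Suc (i + n)) A \<le> \<sigma> (Suc i) (A - truncation A n u)"
    by (rule sing_val_diff_rank_le[OF truncation_rank_le[OF A]])
qed

section \<open>Optimality in both norms and comparison of the norms\<close>

lemma hs_norm_mono:
  assumes "\<And>i. \<sigma> (Suc i) A \<le> \<sigma> (Suc i) B"
  shows "hs_norm s1 s2 A \<le> hs_norm s1 s2 B"
proof (cases "summable (\<lambda>i. (\<sigma> (Suc i) B)\<^sup>2)")
  case True
  have le: "(\<sigma> (Suc i) A)\<^sup>2 \<le> (\<sigma> (Suc i) B)\<^sup>2" for i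
    using assms sing_val_nonneg by (intro power_mono)
  have "summable (\<lambda>i. (\<sigma> (Suc i) A)\<^sup>2)"
    using True by (rule summable_comparison_test') (use le in auto)
  then show ?thesis
    unfolding hs_norm_def using True le by (simp add: suminf_le)
qed (simp add: hs_norm_def)

text \<open>In the Hilbert-Schmidt norm the comparison is made singular value by singular value. It
  covers divergent series: if the residual has infinite norm, so has every
  \<open>A - L\<close>.\<close>

lemma truncation_optimal:
  assumes A: "A \<in> compact_ops s1 s2" and u: "singular_system A n u"
  shows "optimal_rank_approx s1 s2 norm n A (truncation A n u)"
    and "optimal_rank_approx s1 s2 (hs_norm s1 s2) n A (truncation A n u)"
proof -
  note M = truncation_rank_le[OF A, of n u]
  show "optimal_rank_approx s1 s2 norm n A (truncation A n u)"
    using M norm_singular_residual[OF A u] by (simp add: optimal_rank_approx_def sing_val_def)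
  have "hs_norm s1 s2 (A - truncation A n u) \<le> hs_norm s1 s2 (A - L)" if "L \<in> rank_le n" for L
    by (rule hs_norm_mono) (simp add: sing_val_residual[OF A u] sing_val_diff_rank_le[OF that])
  then have "hs_norm s1 s2 (A - truncation A n u) = (INF L\<in>rank_le n. hs_norm s1 s2 (A - L))"
    using M by (intro antisym INF_greatest INF_lower)
  then show "optimal_rank_approx s1 s2 (hs_norm s1 s2) n A (truncation A n u)"
    using M by (simp add: optimal_rank_approx_def)
qed

lemma sing_val_rank_le_eq_0:
  assumes "L \<in> rank_le m" "m \<le> i"
  shows "\<sigma> (Suc i) L = 0"
  using sing_val_le[OF rank_le_mono[OF assms], of L] sing_val_nonneg[of i L] by simp

text \<open>At most \<open>m\<close> singular values are nonzero, and each is at most the operator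
  norm.\<close>

lemma hs_norm_rank_le:
  assumes L: "L \<in> rank_le m"
  shows "hs_norm s1 s2 L \<le> ereal (sqrt (real m) * norm L)"
proof -
  have fin: "(\<sigma> (Suc i) L)\<^sup>2 = 0" if "i \<notin> {..<m}" for i
    using sing_val_rank_le_eq_0[OF L, of i] that by simp
  have s: "summable (\<lambda>i. (\<sigma> (Suc i) L)\<^sup>2)"
    using fin by (rule summable_finite[OF finite_lessThan])
  have "(\<Sum>i. (\<sigma> (Suc i) L)\<^sup>2) = (\<Sum>i<m. (\<sigma> (Suc i) L)\<^sup>2)"
    using fin by (rule suminf_finite[OF finite_lessThan])
  also have "\<dots> \<le> (\<Sum>i<m. (norm L)\<^sup>2)"
    by (intro sum_mono power_mono sing_val_le_norm sing_val_nonneg)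
  finally have "sqrt (\<Sum>i. (\<sigma> (Suc i) L)\<^sup>2) \<le> sqrt (real m * (norm L)\<^sup>2)"
    by simp
  then show ?thesis by (simp add: hs_norm_def s real_sqrt_mult)
qed

lemma norm_le_hs_norm: "ereal (norm A) \<le> hs_norm s1 s2 A"
proof (cases "summable (\<lambda>i. (\<sigma> (Suc i) A)\<^sup>2)")
  case True
  have "(norm A)\<^sup>2 \<le> (\<Sum>i. (\<sigma> (Suc i) A)\<^sup>2)"
    using sum_le_suminf[OF True, of "{0}"] by (simp add: sing_val_1)
  then have "norm A \<le> sqrt (\<Sum>i. (\<sigma> (Suc i) A)\<^sup>2)" by (rule real_le_rsqrt)
  then show ?thesis using True by (simp add: hs_norm_def)
qed (simp add: hs_norm_def)

lemma rank_le_hs_ops: "L \<in> rank_le m \<Longrightarrow> L \<in> hs_ops s1 s2"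
  unfolding hs_ops_def
  using le_less_trans[OF hs_norm_rank_le[of L m], of \<infinity>] rank_le_compact[of L m] by simp

end

section \<open>Continuity of the truncation\<close>

context hilbert_pair
begin

text \<open>A quantitative Ky Fan principle. Combined with \<open>proj_diff_le\<close> it gives continuity of the
  spectral projection without resolvents or adjoints.\<close>

lemma singular_gap_residual:
  assumes A: "A \<in> compact_ops s1 s2" and u: "singular_system A n u" and n: "n \<ge> 1"
    and w: "H1.orthonormal n w"
  shows "((\<sigma> n A)\<^sup>2 - (\<sigma> (Suc n) A)\<^sup>2) * (\<Sum>k<n. (norm (w k - H1.proj n u (w k)))\<^sup>2)
    \<le> (\<Sum>k<n. (norm (A (u k)))\<^sup>2 - (norm (A (w k)))\<^sup>2)"
proof -
  note on = singular_system_orthonormal[OF u]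
  define s where "s i = (norm (A (u i)))\<^sup>2" for i
  define p where "p i k = (norm (ip1 (w k) (u i)))\<^sup>2" for i k
  define c where "c i = (\<Sum>k<n. p i k)" for i
  define z where "z k = w k - H1.proj n u (w k)" for k
  define D where "D = (\<Sum>k<n. (norm (z k))\<^sup>2)"
  \<comment> \<open>Split \<open>w k\<close> into its projection and the residual
    \<open>z k\<close>. The images are orthogonal by the eigenvector equation; the projected part is
    diagonal, and the residual is stretched by at most \<open>\<sigma> (Suc n) A\<close>.\<close>
  have energy: "(norm (A (w k)))\<^sup>2 \<le> (\<Sum>i<n. p i k * s i) + (\<sigma> (Suc n) A)\<^sup>2 * (norm (z k))\<^sup>2" for k
  proof -
    have zu: "ip1 (z k) (u i) = 0" if "i < n" for i
      unfolding z_def by (rule H1.ip_residual[OF on that])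
    have "ip2 (A (z k)) (A (u i)) = 0" if "i < n" for i
      by (simp add: singular_system_eq[OF u that] zu[OF that])
    then have "ip2 (A (z k)) (A (H1.proj n u (w k))) = 0"
      by (auto simp: H1.proj_apply blinfun.sum_right compact_ops_scale[OF A] H2.ip_sum_right
            H2.ip_scale_right intro!: sum.neutral)
    from H2.pythagoras[OF this]
    have "(norm (A (w k)))\<^sup>2 = (norm (A (z k)))\<^sup>2 + (norm (A (H1.proj n u (w k))))\<^sup>2"
      by (simp add: z_def flip: blinfun.add_right)
    moreover have "(norm (A (H1.proj n u (w k))))\<^sup>2 = (\<Sum>i<n. p i k * s i)"
      unfolding H1.proj_apply p_def s_def by (rule norm_singular_combination[OF A u order_refl])
    moreover have "(norm (A (z k)))\<^sup>2 \<le> (\<sigma> (Suc n) A * norm (z k))\<^sup>2"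
    proof (rule power_mono)
      have "H1.proj n u (z k) = 0" by (simp add: H1.proj_apply zu)
      then have "A (z k) = (A - truncation A n u) (z k)"
        by (simp add: blinfun.diff_left truncation_apply)
      then show "norm (A (z k)) \<le> \<sigma> (Suc n) A * norm (z k)"
        by (metis norm_blinfun norm_singular_residual[OF A u])
    qed simp
    ultimately show ?thesis by (simp add: power_mult_distrib)
  qed
  have D: "D = (\<Sum>i<n. 1 - c i)"
  proof -
    have "(norm (z k))\<^sup>2 = 1 - (\<Sum>i<n. p i k)" if "k < n" for k
      using H1.proj_pythagoras[OF on, of "w k"] H1.orthonormal_norm[OF w that]
      by (simp add: H1.norm_proj_square[OF on] z_def p_def)
    then have "D = (\<Sum>k<n. 1 - (\<Sum>i<n. p i k))" by (simp add: D_def)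
    also have "\<dots> = (\<Sum>i<n. 1 - c i)"
      unfolding c_def sum_subtractf by (subst (2) sum.swap) (rule refl)
    finally show ?thesis .
  qed
  have c_le: "c i \<le> 1" if "i < n" for i
    using H1.bessel[OF w, of "u i"] H1.orthonormal_norm[OF on that]
    by (simp add: c_def p_def H1.norm_ip_commute[of "w _" "u i"])
  have "(\<Sum>k<n. (norm (A (w k)))\<^sup>2) \<le> (\<Sum>k<n. (\<Sum>i<n. p i k * s i) + (\<sigma> (Suc n) A)\<^sup>2 * (norm (z k))\<^sup>2)"
    by (intro sum_mono energy)
  also have "\<dots> = (\<Sum>i<n. c i * s i) + (\<sigma> (Suc n) A)\<^sup>2 * D"
    unfolding sum.distrib D_def c_def sum_distrib_left sum_distrib_right by (subst sum.swap) (rule refl)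
  finally have 1: "(\<Sum>k<n. (norm (A (w k)))\<^sup>2) \<le> (\<Sum>i<n. c i * s i) + (\<sigma> (Suc n) A)\<^sup>2 * D" .
  \<comment> \<open>\<open>1 - c i\<close> is the part of \<open>u i\<close> missed by the frame
    \<open>w\<close>. It is nonnegative by Bessel, so each \<open>s i\<close> may be replaced from
    below by the smallest one, \<open>(\<sigma> n A)\<^sup>2\<close>.\<close>
  have "(\<sigma> n A)\<^sup>2 * D = (\<Sum>i<n. (\<sigma> n A)\<^sup>2 * (1 - c i))"
    by (simp add: D sum_distrib_left)
  also have "\<dots> \<le> (\<Sum>i<n. s i * (1 - c i))"
  proof (intro sum_mono mult_right_mono)
    fix i assume "i \<in> {..<n}"
    then have i: "i < n" by simp
    show "0 \<le> 1 - c i" using c_le[OF i] by simp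
    have "\<sigma> n A \<le> \<sigma> (Suc i) A" using sing_val_antimono[of i "n - 1" A] i n by simp
    then show "(\<sigma> n A)\<^sup>2 \<le> s i"
      unfolding s_def norm_singular_vector[OF A u i]
      using sing_val_nonneg[of "n - 1" A] n by (intro power_mono) auto
  qed
  also have "\<dots> = (\<Sum>i<n. s i) - (\<Sum>i<n. c i * s i)"
    by (simp add: algebra_simps sum_subtractf)
  finally have "((\<sigma> n A)\<^sup>2 - (\<sigma> (Suc n) A)\<^sup>2) * D \<le> (\<Sum>i<n. s i) - (\<Sum>k<n. (norm (A (w k)))\<^sup>2)"
    using 1 by (simp add: left_diff_distrib)
  then show ?thesis by (simp add: D_def z_def s_def sum_subtractf)
qed

text \<open>The vectors \<open>v k\<close> maximise for \<open>B\<close>, yet lose little energy for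
  \<open>A\<close>: passing from \<open>A\<close> to \<open>B\<close> at \<open>v k\<close> and from
  the singular value of \<open>B\<close> to that of \<open>A\<close> costs
  \<open>norm (B - A)\<close> each, and factoring the difference of squares adds
  \<open>2 * norm A\<close>. With Q and P the projections of \<open>v\<close> and \<open>u\<close>,
  the bound follows from BQ - AP = (B - A)Q - A(P - Q). Only the gap of \<open>A\<close> enters, so
  \<open>B\<close> may vary.\<close>

lemma truncation_diff_le:
  assumes A: "A \<in> compact_ops s1 s2" and B: "B \<in> compact_ops s1 s2"
    and u: "singular_system A n u" and v: "singular_system B n v"
    and n: "n \<ge> 1" and gap: "\<sigma> (Suc n) A < \<sigma> n A"
  shows "norm (truncation B n v - truncation A n u) \<le> norm (B - A) +
    norm A * (2 * sqrt (4 * real n * norm A * norm (B - A) / ((\<sigma> n A)\<^sup>2 - (\<sigma> (Suc n) A)\<^sup>2)))"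
proof -
  let ?P = "H1.proj n u" and ?Q = "H1.proj n v"
  let ?D = "\<Sum>k<n. (norm (v k - ?P (v k)))\<^sup>2"
  let ?g = "(\<sigma> n A)\<^sup>2 - (\<sigma> (Suc n) A)\<^sup>2"
  note onu = singular_system_orthonormal[OF u] and onv = singular_system_orthonormal[OF v]
  have g: "?g > 0"
    using power_strict_mono[OF gap sing_val_nonneg, of 2] by simp
  have deficit: "(norm (A (u k)))\<^sup>2 - (norm (A (v k)))\<^sup>2 \<le> 4 * norm A * norm (B - A)" if "k < n" for k
  proof -
    let ?p = "norm (A (u k))" and ?q = "norm (A (v k))"
    have uv1: "norm (u k) = 1" "norm (v k) = 1"
      using H1.orthonormal_norm onu onv that by auto
    have "norm (B (v k)) \<le> ?q + norm (B - A)"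
      using norm_triangle_ineq[of "A (v k)" "(B - A) (v k)"] norm_blinfun[of "B - A" "v k"]
      by (simp add: uv1 blinfun.diff_left)
    moreover have "?p \<le> norm (B (v k)) + norm (A - B)"
      using sing_val_perturb[of k A B]
      by (simp add: norm_singular_vector[OF A u that] norm_singular_vector[OF B v that])
    ultimately have pq: "?p - ?q \<le> 2 * norm (B - A)" by (simp add: norm_minus_commute)
    have "?p \<le> norm A" "?q \<le> norm A"
      using norm_blinfun[of A "u k"] norm_blinfun[of A "v k"] by (simp_all add: uv1)
    then have sum_le: "?p + ?q \<le> 2 * norm A" by simp
    have "?p\<^sup>2 - ?q\<^sup>2 = (?p - ?q) * (?p + ?q)"
      by (simp add: power2_eq_square algebra_simps)
    also have "\<dots> \<le> 2 * norm (B - A) * (?p + ?q)"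
      by (rule mult_right_mono[OF pq]) simp
    also have "\<dots> \<le> 2 * norm (B - A) * (2 * norm A)"
      by (rule mult_left_mono[OF sum_le]) simp
    finally show ?thesis by (simp add: mult_ac)
  qed
  have "?g * ?D \<le> (\<Sum>k<n. (norm (A (u k)))\<^sup>2 - (norm (A (v k)))\<^sup>2)"
    by (rule singular_gap_residual[OF A u n onv])
  also have "\<dots> \<le> (\<Sum>k<n. 4 * norm A * norm (B - A))"
    by (intro sum_mono deficit) simp
  also have "\<dots> = 4 * real n * norm A * norm (B - A)" by simp
  finally have "?D \<le> 4 * real n * norm A * norm (B - A) / ?g"
    using g by (simp add: field_simps)
  then have PQ: "norm (?P - ?Q) \<le> 2 * sqrt (4 * real n * norm A * norm (B - A) / ?g)"
    using H1.proj_diff_le[OF onu onv] by (smt (verit) real_sqrt_le_mono)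
  have "norm ?Q \<le> 1"
    by (rule norm_blinfun_bound) (auto simp: H1.norm_proj_le[OF onv])
  then have 1: "norm ((B - A) o\<^sub>L ?Q) \<le> norm (B - A)"
    using norm_blinfun_compose[of "B - A" ?Q]
      mult_left_mono[of "norm ?Q" 1 "norm (B - A)"] by simp
  have 2: "norm (A o\<^sub>L (?P - ?Q)) \<le> norm A * (2 * sqrt (4 * real n * norm A * norm (B - A) / ?g))"
    by (rule order_trans[OF norm_blinfun_compose mult_left_mono[OF PQ norm_ge_zero]])
  have "truncation B n v - truncation A n u = ((B - A) o\<^sub>L ?Q) - (A o\<^sub>L (?P - ?Q))"
    by (rule blinfun_eqI) (simp add: truncation_apply blinfun.diff_left blinfun.diff_right)
  then show ?thesis
    using norm_triangle_ineq4[of "(B - A) o\<^sub>L ?Q" "A o\<^sub>L (?P - ?Q)"] 1 2 by simp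
qed

lemma continuous_on_truncation:
  fixes A :: "'x::topological_space \<Rightarrow> 'a \<Rightarrow>\<^sub>L 'b"
  assumes A: "\<And>\<xi>. \<xi> \<in> X \<Longrightarrow> A \<xi> \<in> compact_ops s1 s2" and cont: "continuous_on X A"
    and u: "\<And>\<xi>. \<xi> \<in> X \<Longrightarrow> singular_system (A \<xi>) n (u \<xi>)" and n: "n \<ge> 1"
    and gap: "\<And>\<xi>. \<xi> \<in> X \<Longrightarrow> \<sigma> (Suc n) (A \<xi>) < \<sigma> n (A \<xi>)"
  shows "continuous_on X (\<lambda>\<xi>. truncation (A \<xi>) n (u \<xi>))"
  unfolding continuous_on_def
proof
  fix \<xi> assume \<xi>: "\<xi> \<in> X"
  let ?g = "\<lambda>e. e + norm (A \<xi>) * (2 * sqrt (4 * real n * norm (A \<xi>) * e /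
    ((\<sigma> n (A \<xi>))\<^sup>2 - (\<sigma> (Suc n) (A \<xi>))\<^sup>2)))"
  have "((\<lambda>\<eta>. A \<eta> - A \<xi>) \<longlongrightarrow> 0) (at \<xi> within X)"
    using cont \<xi> by (auto simp: continuous_on_def intro: Lim_null[THEN iffD1])
  then have "((\<lambda>\<eta>. ?g (norm (A \<eta> - A \<xi>))) \<longlongrightarrow> ?g (norm (0 :: 'a \<Rightarrow>\<^sub>L 'b))) (at \<xi> within X)"
    unfolding divide_inverse by (intro tendsto_intros)
  then have lim: "((\<lambda>\<eta>. ?g (norm (A \<eta> - A \<xi>))) \<longlongrightarrow> 0) (at \<xi> within X)" by simp
  have "\<forall>\<^sub>F \<eta> in at \<xi> within X. norm (truncation (A \<eta>) n (u \<eta>) - truncation (A \<xi>) n (u \<xi>))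
      \<le> ?g (norm (A \<eta> - A \<xi>))"
    unfolding eventually_at_filter
    by (intro always_eventually allI impI truncation_diff_le A u n gap \<xi>)
  from Lim_null_comparison[OF this lim]
  show "((\<lambda>\<xi>. truncation (A \<xi>) n (u \<xi>)) \<longlongrightarrow> truncation (A \<xi>) n (u \<xi>)) (at \<xi> within X)"
    by (rule Lim_null[THEN iffD2])
qed

section \<open>Left singular vectors and continuity of the range projection\<close>

definition left_vector :: "('a \<Rightarrow>\<^sub>L 'b) \<Rightarrow> (nat \<Rightarrow> 'a) \<Rightarrow> nat \<Rightarrow> 'b" where
  "left_vector A u i = s2 (of_real (1 / norm (A (u i)))) (A (u i))"

lemma left_vector_orthonormal:
  assumes u: "singular_system A n u"
  shows "H2.orthonormal n (left_vector A u)"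
  unfolding H2.orthonormal_def
proof (intro allI impI)
  fix i j assume ij: "i < n" "j < n"
  show "ip2 (left_vector A u i) (left_vector A u j) = (if i = j then 1 else 0)"
  proof (cases "i = j")
    case True
    have "norm (A (u i)) \<noteq> 0" using singular_system_nonzero[OF u ij(1)] by simp
    then show ?thesis using True
      by (simp add: left_vector_def H2.ip_self H2.norm_scale norm_divide)
  next
    case False
    then show ?thesis
      using singular_system_orthogonal[OF u ij]
      by (simp add: left_vector_def H2.ip_scale_left H2.ip_scale_right)
  qed
qed

lemma proj_left_vector_truncation:
  assumes A: "A \<in> compact_ops s1 s2" and u: "singular_system A n u"
  shows "H2.proj n (left_vector A u) (truncation A n u x) = truncation A n u x"
proof (rule H2.proj_eq_self[OF left_vector_orthonormal[OF u]])
  have "A (u i) = s2 (of_real (norm (A (u i)))) (left_vector A u i)" if "i < n" for i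
    using singular_system_nonzero[OF u that] by (simp add: left_vector_def flip: of_real_mult)
  then have "A (u i) \<in> H2.span (left_vector A u ` {..<n})" if "i < n" for i
    using that by (metis H2.span_base H2.span_scale imageI lessThan_iff)
  then show "truncation A n u x \<in> H2.span (left_vector A u ` {..<n})"
    by (auto simp: truncation_apply H1.proj_apply blinfun.sum_right compact_ops_scale[OF A]
          intro!: H2.span_sum H2.span_scale)
qed

text \<open>The left vector of \<open>A\<close> at \<open>k\<close> is its truncation applied to
  \<open>u k\<close>, divided by a singular value that is at least \<open>\<sigma> n A\<close>. The
  same expression with the truncation of \<open>B\<close> lies in the range of \<open>?Q\<close>, so
  the residual is controlled by the difference of the truncations, with no second gap
  argument.\<close>

lemma left_proj_diff_le:
  assumes A: "A \<in> compact_ops s1 s2" and B: "B \<in> compact_ops s1 s2"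
    and u: "singular_system A n u" and v: "singular_system B n v" and n: "n \<ge> 1"
  shows "norm (H2.proj n (left_vector B v) - H2.proj n (left_vector A u))
    \<le> 2 * (sqrt (real n) * (norm (truncation B n v - truncation A n u) / \<sigma> n A))"
proof -
  let ?Q = "H2.proj n (left_vector B v)" and ?f = "left_vector A u"
  let ?d = "norm (truncation B n v - truncation A n u) / \<sigma> n A"
  note on = left_vector_orthonormal[OF v]
  have "norm (A (u (n - 1))) = \<sigma> n A" using norm_singular_vector[OF A u, of "n - 1"] n by simp
  moreover have "A (u (n - 1)) \<noteq> 0" using singular_system_nonzero[OF u, of "n - 1"] n by simp
  ultimately have pos: "\<sigma> n A > 0" by (metis zero_less_norm_iff)
  have res: "norm (?f k - ?Q (?f k)) \<le> ?d" if "k < n" for k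
  proof -
    let ?s = "norm (A (u k))"
    define r where "r = (truncation A n u - truncation B n v) (u k)"
    have Au: "A (u k) = truncation A n u (u k)"
      by (simp add: truncation_apply H1.proj_self[OF singular_system_orthonormal[OF u] that])
    have "?f k = (1 / ?s) *\<^sub>R (truncation B n v (u k) + r)"
      unfolding left_vector_def H2.scale_of_real r_def blinfun.diff_left Au by simp
    then have "?f k - ?Q (?f k) = (1 / ?s) *\<^sub>R (r - ?Q r)"
      by (simp add: blinfun.scaleR_right blinfun.add_right proj_left_vector_truncation[OF B v]
            scaleR_right_diff_distrib scaleR_right_distrib)
    then have "norm (?f k - ?Q (?f k)) = norm (r - ?Q r) / ?s" by simp
    also have "\<dots> \<le> norm r / ?s"
      by (intro divide_right_mono H2.norm_residual_le on) simp
    also have "\<dots> \<le> norm (truncation B n v - truncation A n u) / \<sigma> n A"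
    proof (rule frac_le)
      show "norm r \<le> norm (truncation B n v - truncation A n u)"
        using norm_blinfun[of "truncation A n u - truncation B n v" "u k"]
          H1.orthonormal_norm[OF singular_system_orthonormal[OF u] that]
        by (simp add: r_def norm_minus_commute)
      show "\<sigma> n A \<le> ?s"
        unfolding norm_singular_vector[OF A u that]
        using sing_val_antimono[of k "n - 1" A] that n by simp
    qed (use pos in auto)
    finally show ?thesis .
  qed
  have "(\<Sum>k<n. (norm (?f k - ?Q (?f k)))\<^sup>2) \<le> (\<Sum>k<n. ?d\<^sup>2)"
    by (intro sum_mono power_mono res) auto
  then have "sqrt (\<Sum>k<n. (norm (?f k - ?Q (?f k)))\<^sup>2) \<le> sqrt (real n * ?d\<^sup>2)"
    by (intro real_sqrt_le_mono) simp
  also have "\<dots> = sqrt (real n) * ?d"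
    using pos by (simp add: real_sqrt_mult)
  finally show ?thesis
    using H2.proj_diff_le[OF on left_vector_orthonormal[OF u]] by linarith
qed

lemma continuous_on_left_proj:
  fixes A :: "'x::topological_space \<Rightarrow> 'a \<Rightarrow>\<^sub>L 'b"
  assumes A: "\<And>\<xi>. \<xi> \<in> X \<Longrightarrow> A \<xi> \<in> compact_ops s1 s2"
    and cont: "continuous_on X (\<lambda>\<xi>. truncation (A \<xi>) n (u \<xi>))"
    and u: "\<And>\<xi>. \<xi> \<in> X \<Longrightarrow> singular_system (A \<xi>) n (u \<xi>)" and n: "n \<ge> 1"
  shows "continuous_on X (\<lambda>\<xi>. H2.proj n (left_vector (A \<xi>) (u \<xi>)))"
  unfolding continuous_on_def
proof
  fix \<xi> assume \<xi>: "\<xi> \<in> X"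
  let ?M = "\<lambda>\<xi>. truncation (A \<xi>) n (u \<xi>)" and ?Q = "\<lambda>\<xi>. H2.proj n (left_vector (A \<xi>) (u \<xi>))"
  let ?g = "\<lambda>e. 2 * (sqrt (real n) * (e / \<sigma> n (A \<xi>)))"
  have "((\<lambda>\<eta>. ?M \<eta> - ?M \<xi>) \<longlongrightarrow> 0) (at \<xi> within X)"
    using cont \<xi> by (auto simp: continuous_on_def intro: Lim_null[THEN iffD1])
  then have "((\<lambda>\<eta>. ?g (norm (?M \<eta> - ?M \<xi>))) \<longlongrightarrow> ?g (norm (0 :: 'a \<Rightarrow>\<^sub>L 'b))) (at \<xi> within X)"
    unfolding divide_inverse by (intro tendsto_intros)
  then have lim: "((\<lambda>\<eta>. ?g (norm (?M \<eta> - ?M \<xi>))) \<longlongrightarrow> 0) (at \<xi> within X)" by simp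
  have "\<forall>\<^sub>F \<eta> in at \<xi> within X. norm (?Q \<eta> - ?Q \<xi>) \<le> ?g (norm (?M \<eta> - ?M \<xi>))"
    unfolding eventually_at_filter
    by (intro always_eventually allI impI left_proj_diff_le A u n \<xi>)
  from Lim_null_comparison[OF this lim]
  show "(?Q \<longlongrightarrow> ?Q \<xi>) (at \<xi> within X)"
    by (rule Lim_null[THEN iffD2])
qed

end

section \<open>Factorization and conclusion\<close>

context hilbert_pair
begin

text \<open>The hypothesis says \<open>w \<xi> = (M \<xi>)\<^sup>* (v \<xi>)\<close>.\<close>

lemma continuous_on_adjoint_image:
  fixes M :: "'x::topological_space \<Rightarrow> 'a \<Rightarrow>\<^sub>L 'b"
  assumes M: "continuous_on X M" and v: "continuous_on X v"
    and adj: "\<And>\<xi> x. \<xi> \<in> X \<Longrightarrow> ip1 x (w \<xi>) = ip2 (M \<xi> x) (v \<xi>)"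
  shows "continuous_on X w"
  unfolding continuous_on_def
proof
  fix \<xi> assume \<xi>: "\<xi> \<in> X"
  let ?g = "\<lambda>\<eta>. norm (M \<eta> - M \<xi>) * norm (v \<eta>) + norm (M \<xi>) * norm (v \<eta> - v \<xi>)"
  have "((\<lambda>\<eta>. M \<eta> - M \<xi>) \<longlongrightarrow> 0) (at \<xi> within X)" "((\<lambda>\<eta>. v \<eta> - v \<xi>) \<longlongrightarrow> 0) (at \<xi> within X)"
    "(v \<longlongrightarrow> v \<xi>) (at \<xi> within X)"
    using M v \<xi> by (auto simp: continuous_on_def intro: Lim_null[THEN iffD1])
  then have "(?g \<longlongrightarrow> norm (0 :: 'a \<Rightarrow>\<^sub>L 'b) * norm (v \<xi>) + norm (M \<xi>) * norm (0 :: 'b)) (at \<xi> within X)"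
    by (intro tendsto_intros)
  then have lim: "(?g \<longlongrightarrow> 0) (at \<xi> within X)" by simp
  have le: "norm (w \<eta> - w \<xi>) \<le> ?g \<eta>" if \<eta>: "\<eta> \<in> X" for \<eta>
  proof (cases "w \<eta> = w \<xi>")
    case False
    \<comment> \<open>Testing the adjoint identity against the difference itself gives
      \<open>norm d\<close> squared on the left and one factor \<open>norm d\<close> on the
      right.\<close>
    define d where "d = w \<eta> - w \<xi>"
    have "ip1 d d = ip1 d (w \<eta>) - ip1 d (w \<xi>)"
      by (subst (2) d_def) (simp add: H1.ip_diff_right)
    also have "\<dots> = ip2 ((M \<eta> - M \<xi>) d) (v \<eta>) + ip2 (M \<xi> d) (v \<eta> - v \<xi>)"
      by (simp add: adj \<eta> \<xi> blinfun.diff_left H2.ip_diff_left H2.ip_diff_right)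
    finally have "norm (ip1 d d) \<le> norm ((M \<eta> - M \<xi>) d) * norm (v \<eta>) + norm (M \<xi> d) * norm (v \<eta> - v \<xi>)"
      by (simp only:) (intro norm_triangle_le add_mono H2.norm_ip_le)
    also have "\<dots> \<le> (norm (M \<eta> - M \<xi>) * norm d) * norm (v \<eta>) + (norm (M \<xi>) * norm d) * norm (v \<eta> - v \<xi>)"
      by (intro add_mono mult_right_mono norm_blinfun) auto
    also have "\<dots> = ?g \<eta> * norm d" by (simp add: algebra_simps)
    finally have "norm d * norm d \<le> ?g \<eta> * norm d"
      by (simp add: H1.ip_self norm_power power2_eq_square norm_mult)
    moreover have "norm d > 0" using False by (simp add: d_def)
    ultimately show ?thesis unfolding d_def[symmetric] by (rule mult_right_le_imp_le)
  qed simp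
  have "\<forall>\<^sub>F \<eta> in at \<xi> within X. norm (w \<eta> - w \<xi>) \<le> ?g \<eta>"
    unfolding eventually_at_filter using le by (intro always_eventually allI impI)
  from Lim_null_comparison[OF this lim]
  show "(w \<longlongrightarrow> w \<xi>) (at \<xi> within X)"
    by (rule Lim_null[THEN iffD2])
qed

text \<open>With \<open>v\<close> a continuous frame of the ranges, the truncation equals its own
  projection, so expanding it in \<open>v\<close> leaves the coefficients
  \<open>ip2 (M x) (v i)\<close>; moving the operator to the other side produces the vectors of the
  domain.\<close>

lemma continuous_truncation_factorization:
  fixes A :: "'x::metric_space \<Rightarrow> 'a \<Rightarrow>\<^sub>L 'b"
  assumes X: "compact X" "contractible X"
    and A: "\<And>\<xi>. \<xi> \<in> X \<Longrightarrow> A \<xi> \<in> compact_ops s1 s2"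
    and cont: "continuous_on X (\<lambda>\<xi>. truncation (A \<xi>) n (u \<xi>))"
    and u: "\<And>\<xi>. \<xi> \<in> X \<Longrightarrow> singular_system (A \<xi>) n (u \<xi>)" and n: "n \<ge> 1"
  shows "continuous_orthonormal_factorization ip1 s2 ip2 n X (\<lambda>\<xi>. truncation (A \<xi>) n (u \<xi>))"
proof -
  let ?M = "\<lambda>\<xi>. truncation (A \<xi>) n (u \<xi>)"
  have "\<exists>v. (\<forall>i<n. continuous_on X (v i)) \<and>
    (\<forall>\<xi>\<in>X. H2.orthonormal n (\<lambda>i. v i \<xi>) \<and> H2.proj n (\<lambda>i. v i \<xi>) = H2.proj n (left_vector (A \<xi>) (u \<xi>)))"
    by (rule H2.contractible_frame[OF X left_vector_orthonormal continuous_on_left_proj[OF A cont u n]])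
       (use u in auto)
  then obtain v where v: "\<And>i. i < n \<Longrightarrow> continuous_on X (v i)"
    "\<And>\<xi>. \<xi> \<in> X \<Longrightarrow> H2.orthonormal n (\<lambda>i. v i \<xi>)"
    "\<And>\<xi>. \<xi> \<in> X \<Longrightarrow> H2.proj n (\<lambda>i. v i \<xi>) = H2.proj n (left_vector (A \<xi>) (u \<xi>))"
    by blast
  \<comment> \<open>The adjoint of the truncation applied to \<open>v i \<xi>\<close>, read off from
    the expansion of the truncation over the \<open>u \<xi> k\<close>.\<close>
  define w where "w i \<xi> = (\<Sum>k<n. s1 (ip2 (v i \<xi>) (A \<xi> (u \<xi> k))) (u \<xi> k))" for i \<xi>
  have adj: "ip1 x (w i \<xi>) = ip2 (?M \<xi> x) (v i \<xi>)" if "\<xi> \<in> X" for x i \<xi>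
    unfolding w_def truncation_apply H1.proj_apply
    by (simp add: H1.ip_sum_right H1.ip_scale_right blinfun.sum_right compact_ops_scale[OF A[OF that]]
          H2.ip_sum_left H2.ip_scale_left mult.commute flip: H2.ip_commute)
  have w: "continuous_on X (w i)" if "i < n" for i
    by (rule continuous_on_adjoint_image[OF cont v(1)[OF that] adj])
  have M: "?M \<xi> x = (\<Sum>i=1..n. s2 (ip1 x (w (i - 1) \<xi>)) (v (i - 1) \<xi>))" if \<xi>: "\<xi> \<in> X" for \<xi> x
  proof -
    have "?M \<xi> x = H2.proj n (\<lambda>i. v i \<xi>) (?M \<xi> x)"
      by (simp add: v(3)[OF \<xi>] proj_left_vector_truncation[OF A u] \<xi>)
    also have "\<dots> = (\<Sum>i<n. s2 (ip1 x (w i \<xi>)) (v i \<xi>))"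
      by (simp add: H2.proj_apply adj[OF \<xi>])
    also have "\<dots> = (\<Sum>i=1..n. s2 (ip1 x (w (i - 1) \<xi>)) (v (i - 1) \<xi>))"
      by (rule sum.reindex_bij_witness[of _ "\<lambda>i. i - 1" Suc]) auto
    finally show ?thesis .
  qed
  show ?thesis
    unfolding continuous_orthonormal_factorization_def
  \<comment> \<open>Frames are indexed from 0 here but from 1 in the factorization, hence the shift
    by one.\<close>
  proof (intro exI[of _ "\<lambda>i. w (i - 1)"] exI[of _ "\<lambda>i. v (i - 1)"] conjI ballI allI)
    fix i assume "i \<in> {1..n}"
    then show "continuous_on X (w (i - 1))" "continuous_on X (v (i - 1))"
      using w v by auto
  next
    fix \<xi> i j assume "\<xi> \<in> X" "i \<in> {1..n}" "j \<in> {1..n}"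
    then show "ip2 (v (i - 1) \<xi>) (v (j - 1) \<xi>) = (if i = j then 1 else 0)"
      using H2.orthonormalD[OF v(2), of \<xi> "i - 1" "j - 1"] by auto
  qed (rule M)
qed

text \<open>The rank bound is exported together with operator-norm continuity because the two yield
  membership in \<open>hs_ops\<close> and continuity in the Hilbert-Schmidt norm.\<close>

theorem continuous_rank_approximation:
  fixes A :: "'x::metric_space \<Rightarrow> 'a \<Rightarrow>\<^sub>L 'b"
  assumes X: "compact X" and n: "n \<ge> 1"
    and A: "\<And>\<xi>. \<xi> \<in> X \<Longrightarrow> A \<xi> \<in> compact_ops s1 s2" and cont: "continuous_on X A"
    and gap: "\<And>\<xi>. \<xi> \<in> X \<Longrightarrow> \<sigma> (Suc n) (A \<xi>) < \<sigma> n (A \<xi>)"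
  obtains M where "\<And>\<xi>. \<xi> \<in> X \<Longrightarrow> M \<xi> \<in> rank_le n" "continuous_on X M"
    "\<And>\<xi>. \<xi> \<in> X \<Longrightarrow> optimal_rank_approx s1 s2 norm n (A \<xi>) (M \<xi>)"
    "\<And>\<xi>. \<xi> \<in> X \<Longrightarrow> optimal_rank_approx s1 s2 (hs_norm s1 s2) n (A \<xi>) (M \<xi>)"
    "contractible X \<Longrightarrow> continuous_orthonormal_factorization ip1 s2 ip2 n X M"
proof -
  have "\<exists>u. singular_system (A \<xi>) n u" if "\<xi> \<in> X" for \<xi>
    using singular_system_exists[OF A[OF that] n] gap[OF that] sing_val_nonneg[of n "A \<xi>"]
    by (meson le_less_trans)
  then obtain u where u: "\<And>\<xi>. \<xi> \<in> X \<Longrightarrow> singular_system (A \<xi>) n (u \<xi>)" by metis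
  have M: "continuous_on X (\<lambda>\<xi>. truncation (A \<xi>) n (u \<xi>))"
    by (rule continuous_on_truncation[OF A cont u n gap])
  show ?thesis
  proof (rule that[OF _ M])
    fix \<xi> assume "\<xi> \<in> X"
    then show "truncation (A \<xi>) n (u \<xi>) \<in> rank_le n"
      "optimal_rank_approx s1 s2 norm n (A \<xi>) (truncation (A \<xi>) n (u \<xi>))"
      "optimal_rank_approx s1 s2 (hs_norm s1 s2) n (A \<xi>) (truncation (A \<xi>) n (u \<xi>))"
      using truncation_rank_le[OF A] truncation_optimal[OF A u] by auto
  next
    assume "contractible X"
    then show "continuous_orthonormal_factorization ip1 s2 ip2 n X (\<lambda>\<xi>. truncation (A \<xi>) n (u \<xi>))"
      by (rule continuous_truncation_factorization[OF X _ A M u n])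
  qed
qed

section \<open>Passage between the operator norm and the Hilbert-Schmidt norm\<close>

lemma hs_continuous_imp_continuous:
  assumes "hs_continuous_on s1 s2 X A"
  shows "continuous_on X A"
  unfolding continuous_on_iff
proof (intro ballI allI impI)
  fix \<xi> and e :: real assume "\<xi> \<in> X" "e > 0"
  then obtain d where d: "d > 0" "\<forall>\<eta>\<in>X. dist \<eta> \<xi> < d \<longrightarrow> hs_norm s1 s2 (A \<eta> - A \<xi>) < ereal e"
    using assms unfolding hs_continuous_on_def by blast
  have "norm (A \<eta> - A \<xi>) < e" if "\<eta> \<in> X" "dist \<eta> \<xi> < d" for \<eta>
    using le_less_trans[OF norm_le_hs_norm d(2)[rule_format, OF that]] by simp
  then show "\<exists>d>0. \<forall>\<eta>\<in>X. dist \<eta> \<xi> < d \<longrightarrow> dist (A \<eta>) (A \<xi>) < e"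
    using d(1) by (auto simp: dist_norm)
qed

lemma finite_rank_hs_continuous:
  fixes M :: "'x::metric_space \<Rightarrow> 'a \<Rightarrow>\<^sub>L 'b"
  assumes cont: "continuous_on X M" and M: "\<And>\<xi>. \<xi> \<in> X \<Longrightarrow> M \<xi> \<in> rank_le n"
  shows "hs_continuous_on s1 s2 X M"
  unfolding hs_continuous_on_def
proof (intro ballI allI impI)
  fix \<xi> and e :: real assume \<xi>: "\<xi> \<in> X" and e: "e > 0"
  \<comment> \<open>The added 1 keeps the divisor positive even for \<open>n = 0\<close>.\<close>
  define c where "c = sqrt (real (n + n)) + 1"
  have c: "c > 0" by (simp add: c_def add_nonneg_pos)
  obtain d where d: "d > 0" "\<And>\<eta>. \<eta> \<in> X \<Longrightarrow> dist \<eta> \<xi> < d \<Longrightarrow> norm (M \<eta> - M \<xi>) < e / c"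
    using cont \<xi> e c unfolding continuous_on_iff dist_norm by (metis divide_pos_pos)
  have "hs_norm s1 s2 (M \<eta> - M \<xi>) < ereal e" if "\<eta> \<in> X" "dist \<eta> \<xi> < d" for \<eta>
  proof -
    have "hs_norm s1 s2 (M \<eta> - M \<xi>) \<le> ereal (sqrt (real (n + n)) * norm (M \<eta> - M \<xi>))"
      by (intro hs_norm_rank_le rank_le_diff M that \<xi>)
    also have "sqrt (real (n + n)) * norm (M \<eta> - M \<xi>) \<le> c * norm (M \<eta> - M \<xi>)"
      by (intro mult_right_mono) (auto simp: c_def)
    also have "\<dots> < e" using d(2)[OF that] c by (simp add: field_simps)
    finally show ?thesis by simp
  qed
  then show "\<exists>d>0. \<forall>\<eta>\<in>X. dist \<eta> \<xi> < d \<longrightarrow> hs_norm s1 s2 (M \<eta> - M \<xi>) < ereal e"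
    using d(1) by blast
qed

end

theorem theorem6:
  fixes s1 :: "'k::rc_field \<Rightarrow> 'a::banach \<Rightarrow> 'a" and ip1 :: "'a \<Rightarrow> 'a \<Rightarrow> 'k"
    and s2 :: "'k \<Rightarrow> 'b::banach \<Rightarrow> 'b" and ip2 :: "'b \<Rightarrow> 'b \<Rightarrow> 'k"
    and \<Xi> :: "'x::metric_space set" and n :: nat
  assumes H1: "hilbert_space s1 ip1" "separable_space (euclidean :: 'a topology)"
    and H2: "hilbert_space s2 ip2" "separable_space (euclidean :: 'b topology)"
    and \<Xi>: "compact \<Xi>"
    and n: "n \<ge> 1"
  shows
    "(\<forall>A :: 'x \<Rightarrow> 'a \<Rightarrow>\<^sub>L 'b.
        (\<forall>\<xi>\<in>\<Xi>. A \<xi> \<in> compact_ops s1 s2) \<and> continuous_on \<Xi> A \<and>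
        (\<forall>\<xi>\<in>\<Xi>. sing_val s1 s2 (n + 1) (A \<xi>) < sing_val s1 s2 n (A \<xi>)) \<longrightarrow>
        (\<exists>M :: 'x \<Rightarrow> 'a \<Rightarrow>\<^sub>L 'b.
           (\<forall>\<xi>\<in>\<Xi>. M \<xi> \<in> compact_ops s1 s2) \<and> continuous_on \<Xi> M \<and>
           (\<forall>\<xi>\<in>\<Xi>. optimal_rank_approx s1 s2 norm n (A \<xi>) (M \<xi>) \<and>
                  optimal_rank_approx s1 s2 (hs_norm s1 s2) n (A \<xi>) (M \<xi>)) \<and>
           (contractible \<Xi> \<longrightarrow> continuous_orthonormal_factorization ip1 s2 ip2 n \<Xi> M)))
     \<and>
     (\<forall>A :: 'x \<Rightarrow> 'a \<Rightarrow>\<^sub>L 'b.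
        (\<forall>\<xi>\<in>\<Xi>. A \<xi> \<in> hs_ops s1 s2) \<and> hs_continuous_on s1 s2 \<Xi> A \<and>
        (\<forall>\<xi>\<in>\<Xi>. sing_val s1 s2 (n + 1) (A \<xi>) < sing_val s1 s2 n (A \<xi>)) \<longrightarrow>
        (\<exists>M :: 'x \<Rightarrow> 'a \<Rightarrow>\<^sub>L 'b.
           (\<forall>\<xi>\<in>\<Xi>. M \<xi> \<in> hs_ops s1 s2) \<and> hs_continuous_on s1 s2 \<Xi> M \<and>
           (\<forall>\<xi>\<in>\<Xi>. optimal_rank_approx s1 s2 norm n (A \<xi>) (M \<xi>) \<and>
                  optimal_rank_approx s1 s2 (hs_norm s1 s2) n (A \<xi>) (M \<xi>)) \<and>
           (contractible \<Xi> \<longrightarrow> continuous_orthonormal_factorization ip1 s2 ip2 n \<Xi> M)))"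
proof -
  interpret hilbert_pair s1 ip1 s2 ip2
    using H1(1) H2(1) by (rule hilbert_pair.intro)
  show ?thesis
  proof (rule conjI; intro allI impI; elim conjE)
    fix A :: "'x \<Rightarrow> 'a \<Rightarrow>\<^sub>L 'b"
    assume A: "\<forall>\<xi>\<in>\<Xi>. A \<xi> \<in> compact_ops s1 s2" "continuous_on \<Xi> A"
      "\<forall>\<xi>\<in>\<Xi>. sing_val s1 s2 (n + 1) (A \<xi>) < sing_val s1 s2 n (A \<xi>)"
    obtain M where "\<And>\<xi>. \<xi> \<in> \<Xi> \<Longrightarrow> M \<xi> \<in> rank_le n" "continuous_on \<Xi> M"
      "\<And>\<xi>. \<xi> \<in> \<Xi> \<Longrightarrow> optimal_rank_approx s1 s2 norm n (A \<xi>) (M \<xi>)"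
      "\<And>\<xi>. \<xi> \<in> \<Xi> \<Longrightarrow> optimal_rank_approx s1 s2 (hs_norm s1 s2) n (A \<xi>) (M \<xi>)"
      "contractible \<Xi> \<Longrightarrow> continuous_orthonormal_factorization ip1 s2 ip2 n \<Xi> M"
      by (rule continuous_rank_approximation[OF \<Xi> n, of A]) (use A in auto)
    then show "\<exists>M. (\<forall>\<xi>\<in>\<Xi>. M \<xi> \<in> compact_ops s1 s2) \<and> continuous_on \<Xi> M \<and>
        (\<forall>\<xi>\<in>\<Xi>. optimal_rank_approx s1 s2 norm n (A \<xi>) (M \<xi>) \<and>
               optimal_rank_approx s1 s2 (hs_norm s1 s2) n (A \<xi>) (M \<xi>)) \<and>
        (contractible \<Xi> \<longrightarrow> continuous_orthonormal_factorization ip1 s2 ip2 n \<Xi> M)"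
      by (intro exI[of _ M]) (auto intro: rank_le_compact)
  next
    fix A :: "'x \<Rightarrow> 'a \<Rightarrow>\<^sub>L 'b"
    assume A: "\<forall>\<xi>\<in>\<Xi>. A \<xi> \<in> hs_ops s1 s2" "hs_continuous_on s1 s2 \<Xi> A"
      "\<forall>\<xi>\<in>\<Xi>. sing_val s1 s2 (n + 1) (A \<xi>) < sing_val s1 s2 n (A \<xi>)"
    \<comment> \<open>Hilbert-Schmidt continuity of \<open>A\<close> implies operator-norm
      continuity, so the same construction of \<open>M\<close> applies.\<close>
    obtain M where M: "\<And>\<xi>. \<xi> \<in> \<Xi> \<Longrightarrow> M \<xi> \<in> rank_le n" "continuous_on \<Xi> M"
      "\<And>\<xi>. \<xi> \<in> \<Xi> \<Longrightarrow> optimal_rank_approx s1 s2 norm n (A \<xi>) (M \<xi>)"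
      "\<And>\<xi>. \<xi> \<in> \<Xi> \<Longrightarrow> optimal_rank_approx s1 s2 (hs_norm s1 s2) n (A \<xi>) (M \<xi>)"
      "contractible \<Xi> \<Longrightarrow> continuous_orthonormal_factorization ip1 s2 ip2 n \<Xi> M"
      by (rule continuous_rank_approximation[OF \<Xi> n, of A])
         (use A hs_continuous_imp_continuous in \<open>auto simp: hs_ops_def\<close>)
    then show "\<exists>M. (\<forall>\<xi>\<in>\<Xi>. M \<xi> \<in> hs_ops s1 s2) \<and> hs_continuous_on s1 s2 \<Xi> M \<and>
        (\<forall>\<xi>\<in>\<Xi>. optimal_rank_approx s1 s2 norm n (A \<xi>) (M \<xi>) \<and>
               optimal_rank_approx s1 s2 (hs_norm s1 s2) n (A \<xi>) (M \<xi>)) \<and>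
        (contractible \<Xi> \<longrightarrow> continuous_orthonormal_factorization ip1 s2 ip2 n \<Xi> M)"
      using finite_rank_hs_continuous[OF M(2,1)]
      by (intro exI[of _ M]) (auto intro: rank_le_hs_ops)
  qed
qed

end
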